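(* Let $\mathcal{M}$ be a finite unitary magma. Then the operad $\mathrm{NC}\mathcal{M}$ admits the presentation $(\mathcal{T}_\mathcal{M}, \mathfrak{R}_{\mathrm{NC}\mathcal{M}})$, that is, $\mathrm{NC}\mathcal{M}$ is isomorphic to the quotient operad $\mathrm{Free}(\mathbb{K}\langle \mathcal{T}_\mathcal{M}\rangle)/\langle \mathfrak{R}_{\mathrm{NC}\mathcal{M}}\rangle$, where $\mathfrak{R}_{\mathrm{NC}\mathcal{M}}$ is the subspace of $\mathrm{Free}(\mathbb{K}\langle \mathcal{T}_\mathcal{M}\rangle)(3)$ spanned by all elements (1) $\mathrm{T}(p_0,p_1,p_2)\circ_1 \mathrm{T}(q_0,q_1,q_2) - \mathrm{T}(p_0,r_1,p_2)\circ_1\mathrm{T}(r_0,q_1,q_2)$ whenever $p_1\star q_0 = r_1\star r_0 \neq 1_\mathcal{M}$; (2) $\mathrm{T}(p_0,p_1,p_2)\circ_1 \mathrm{T}(q_0,q_1,q_2) - \mathrm{T}(p_0,q_1,r_2)\circ_2\mathrm{T}(r_0,q_2,p_2)$ whenever $p_1\star q_0 = r_2\star r_0 = 1_\mathcal{M}$; (3) $\mathrm{T}(p_0,p_1,p_2)\circ_2 \mathrm{T}(q_0,q_1,q_2) - \mathrm{T}(p_0,p_1,r_2)\circ_2\mathrm{T}(r_0,q_1,q_2)$ whenever $p_2\star q_0 = r_2\star r_0 \neq 1_\mathcal{M}$; where all $p_j,q_j,r_j$ range over $\mathcal{M}$, and $\langle \mathfrak{R}_{\mathrm{NC}\mathcal{M}}\rangle$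 denotes the operad ideal generated by $\mathfrak{R}_{\mathrm{NC}\mathcal{M}}$.
   Context: $\mathbb{K}$ is a field of characteristic zero. A unitary magma $\mathcal{M}$ is a set with a binary operation $\star$ admitting a two-sided unit $1_\mathcal{M}$. For $n\ge 1$, an $\mathcal{M}$-clique of arity $n$ is a labeling $\mathfrak{p}$ assigning to each arc $(x,y)$, $1\le x<y\le n+1$, of a polygon with vertices $1,\dots,n+1$ an element $\mathfrak{p}(x,y)\in\mathcal{M}$; the arc $(1,n+1)$ is the base, the arcs $(i,i+1)$, $i\in[n]$, are the edges, the others are diagonals; write $\mathfrak{p}_0:=\mathfrak{p}(1,n+1)$ and $\mathfrak{p}_i:=\mathfrak{p}(i,i+1)$. By convention there is exactly one $\mathcal{M}$-clique of arity $1$ (the unit). An arc is solid if its label differs from $1_\mathcal{M}$. Diagonals $(x,y),(x',y')$ cross if $x<x'<y<y'$ or $x'<x<y'<y$; an $\mathcal{M}$-clique is noncrossing if no two solid diagonals cross. For $\mathfrak{p}$ of arity $n$, $\mathfrak{q}$ of arity $m$ and $i\in[n]$, the partial composition $\mathfrak{p}\circ_i\mathfrak{q}$ is the $\mathcal{M}$-clique $\mathfrak{r}$ of arity $n+m-1$ obtained by gluing the base of $\mathfrak{q}$ onto the $i$th edge of $\mathfrak{p}$: with $\varphi(x)=x$ for $x\le i$ and $\varphi(x)=x+m-1$ for $x>i$, one sets $\mathfrak{r}(\varphi(x),\varphi(y))=\mathfrak{p}(x,y)$ for arcs $(x,y)\neq(i,i+1)$ of $\mathfrak{p}$, $\mathfrak{r}(x+i-1,y+i-1)=\mathfrak{q}(x,y)$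 for arcs $(x,y)\neq(1,m+1)$ of $\mathfrak{q}$, $\mathfrak{r}(i,i+m)=\mathfrak{p}_i\star\mathfrak{q}_0$, and all other arcs of $\mathfrak{r}$ are labeled $1_\mathcal{M}$. The linear span of all $\mathcal{M}$-cliques with these compositions (and the arity-1 clique as unit) is an operad $\mathsf{C}\mathcal{M}$; $\mathrm{NC}\mathcal{M}$ is its suboperad spanned by noncrossing $\mathcal{M}$-cliques. An $\mathcal{M}$-triangle is an $\mathcal{M}$-clique of arity $2$; $\mathcal{T}_\mathcal{M}$ is the set of $\mathcal{M}$-triangles, and $\mathrm{T}(a,b,c)$ denotes the triangle with base labeled $a$, first edge $b$, second edge $c$. $\mathrm{Free}(\mathbb{K}\langle\mathcal{T}_\mathcal{M}\rangle)$ is the free (nonsymmetric) operad on the generators $\mathcal{T}_\mathcal{M}$ (of arity $2$), with basis the syntax trees whose internal nodes are labeled by $\mathcal{M}$-triangles; $\mathrm{T}(\cdot)\circ_i\mathrm{T}(\cdot)$ denotes the corresponding degree-2 syntax tree. *)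

theory Defs
  imports Complex_Main "HOL-Library.FuncSet" "HOL-Library.Poly_Mapping" "HOL-Library.Tree"
begin

section \<open>Nonsymmetric linear operads\<close>

text \<open>
  The data of a nonsymmetric operad over a field: for each arity \<open>n\<close> the carrier
  \<open>component P n\<close> of a vector space with its operations, the partial compositions
  \<open>pcomp P n m i x y\<close> (that is, \<open>x\<close> of arity \<open>n\<close> composed at input \<open>i\<close> with \<open>y\<close> of arity \<open>m\<close>,
  meaningful for \<open>1 \<le> i \<le> n\<close> and \<open>1 \<le> m\<close>), and the unit in arity 1. All operations are indexed by
  arities because the zero and the scalar multiplication of a quotient depend on the arity.
  Operads here start in arity 1; the components of arity 0 are zero spaces.
\<close>

record ('k, 'v) operad =
  component :: "nat \<Rightarrow> 'v set"
  vadd :: "nat \<Rightarrow> 'v \<Rightarrow> 'v \<Rightarrow> 'v"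
  vzero :: "nat \<Rightarrow> 'v"
  vscale :: "nat \<Rightarrow> 'k \<Rightarrow> 'v \<Rightarrow> 'v"
  pcomp :: "nat \<Rightarrow> nat \<Rightarrow> nat \<Rightarrow> 'v \<Rightarrow> 'v \<Rightarrow> 'v"
  ounit :: 'v

definition operad_hom :: "('k, 'v) operad \<Rightarrow> ('k, 'w) operad \<Rightarrow> (nat \<Rightarrow> 'v \<Rightarrow> 'w) \<Rightarrow> bool" where
  "operad_hom P Q f \<longleftrightarrow>
     (\<forall>n. f n \<in> component P n \<rightarrow> component Q n) \<and>
     (\<forall>n. \<forall>x\<in>component P n. \<forall>y\<in>component P n. f n (vadd P n x y) = vadd Q n (f n x) (f n y)) \<and>
     (\<forall>n c. \<forall>x\<in>component P n. f n (vscale P n c x) = vscale Q n c (f n x)) \<and>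
     f 1 (ounit P) = ounit Q \<and>
     (\<forall>n m. \<forall>i\<in>{1..n}. \<forall>x\<in>component P n. \<forall>y\<in>component P m. 1 \<le> m \<longrightarrow>
        f (n + m - 1) (pcomp P n m i x y) = pcomp Q n m i (f n x) (f m y))"

definition operad_isomorphic :: "('k, 'v) operad \<Rightarrow> ('k, 'w) operad \<Rightarrow> bool" where
  "operad_isomorphic P Q \<longleftrightarrow>
     (\<exists>f. operad_hom P Q f \<and> (\<forall>n. bij_betw (f n) (component P n) (component Q n)))"

definition operad_ideal :: "('k, 'v) operad \<Rightarrow> (nat \<Rightarrow> 'v set) \<Rightarrow> bool" where
  "operad_ideal P I \<longleftrightarrow>
     (\<forall>n. I n \<subseteq> component P n \<and> vzero P n \<in> I n) \<and>
     (\<forall>n. \<forall>x\<in>I n. \<forall>y\<in>I n. vadd P n x y \<in> I n) \<and>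
     (\<forall>n c. \<forall>x\<in>I n. vscale P n c x \<in> I n) \<and>
     (\<forall>n m. \<forall>i\<in>{1..n}. 1 \<le> m \<longrightarrow>
        (\<forall>x\<in>I n. \<forall>y\<in>component P m. pcomp P n m i x y \<in> I (n + m - 1)) \<and>
        (\<forall>x\<in>component P n. \<forall>y\<in>I m. pcomp P n m i x y \<in> I (n + m - 1)))"

definition generated_ideal :: "('k, 'v) operad \<Rightarrow> (nat \<Rightarrow> 'v set) \<Rightarrow> nat \<Rightarrow> 'v set" where
  "generated_ideal P R n = \<Inter>{I n | I. operad_ideal P I \<and> (\<forall>k. R k \<subseteq> I k)}"

definition coset :: "('k, 'v) operad \<Rightarrow> (nat \<Rightarrow> 'v set) \<Rightarrow> nat \<Rightarrow> 'v \<Rightarrow> 'v set" where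
  "coset P I n x = vadd P n x ` I n"

text \<open>
  The operations on cosets are formed by applying the operation to all representatives; when \<open>I\<close> is
  an ideal of an operad all the cosets in each union coincide.
\<close>

definition quotient_operad :: "('k, 'v) operad \<Rightarrow> (nat \<Rightarrow> 'v set) \<Rightarrow> ('k, 'v set) operad" where
  "quotient_operad P I =
    \<lparr> component = (\<lambda>n. coset P I n ` component P n),
      vadd = (\<lambda>n A B. \<Union>a\<in>A. \<Union>b\<in>B. coset P I n (vadd P n a b)),
      vzero = (\<lambda>n. coset P I n (vzero P n)),
      vscale = (\<lambda>n c A. \<Union>a\<in>A. coset P I n (vscale P n c a)),
      pcomp = (\<lambda>n m i A B. \<Union>a\<in>A. \<Union>b\<in>B. coset P I (n + m - 1) (pcomp P n m i a b)),
      ounit = coset P I 1 (ounit P) \<rparr>"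


section \<open>Linear spans of combinatorial objects\<close>

text \<open>
  The formal linear combinations of objects of type \<open>'a\<close> are the finitely supported functions
  \<open>'a \<Rightarrow>\<^sub>0 'k\<close>, and the object \<open>x\<close> itself is \<open>Poly_Mapping.single x 1\<close>.
\<close>

definition fscale :: "'k::field \<Rightarrow> ('a \<Rightarrow>\<^sub>0 'k) \<Rightarrow> ('a \<Rightarrow>\<^sub>0 'k)" where
  "fscale c = Poly_Mapping.map ((*) c)"

lemma lookup_fscale [simp]: "Poly_Mapping.lookup (fscale c f) x = c * Poly_Mapping.lookup f x"
  by (simp add: fscale_def Poly_Mapping.map.rep_eq when_def)

global_interpretation formal: vector_space "fscale :: 'k::field \<Rightarrow> ('a \<Rightarrow>\<^sub>0 'k) \<Rightarrow> _"
  by unfold_locales (auto intro!: poly_mapping_eqI simp: lookup_add algebra_simps)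

text \<open>
  The linear span of a graded family of sets \<open>B\<close>, with partial compositions extended bilinearly
  from a composition \<open>c n m i\<close> of basis elements.
\<close>

definition linear_operad ::
    "(nat \<Rightarrow> 'a set) \<Rightarrow> (nat \<Rightarrow> nat \<Rightarrow> nat \<Rightarrow> 'a \<Rightarrow> 'a \<Rightarrow> 'a) \<Rightarrow> 'a \<Rightarrow> ('k::field, 'a \<Rightarrow>\<^sub>0 'k) operad" where
  "linear_operad B c u =
    \<lparr> component = (\<lambda>n. {f. Poly_Mapping.keys f \<subseteq> B n}),
      vadd = (\<lambda>n. (+)),
      vzero = (\<lambda>n. 0),
      vscale = (\<lambda>n. fscale),
      pcomp = (\<lambda>n m i f g. \<Sum>x\<in>Poly_Mapping.keys f. \<Sum>y\<in>Poly_Mapping.keys g.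
                 Poly_Mapping.single (c n m i x y) (Poly_Mapping.lookup f x * Poly_Mapping.lookup g y)),
      ounit = Poly_Mapping.single u 1 \<rparr>"


section \<open>The free operad on binary generators\<close>

text \<open>
  Syntax trees on generators that are all of arity 2 are binary trees with labelled internal nodes;
  the arity is the number of leaves, \<open>size1\<close>. The tree \<open>graft t i s\<close> is obtained by grafting the
  root of \<open>s\<close> onto the \<open>i\<close>-th leaf of \<open>t\<close>, leaves being numbered from left to right from 1.
\<close>

fun graft :: "'g tree \<Rightarrow> nat \<Rightarrow> 'g tree \<Rightarrow> 'g tree" where
  "graft Leaf i s = s"
| "graft (Node l g r) i s =
     (if i \<le> size1 l then Node (graft l i s) g r else Node l g (graft r (i - size1 l) s))"

definition syntax_trees :: "'g set \<Rightarrow> nat \<Rightarrow> 'g tree set" where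
  "syntax_trees G n = {t. set_tree t \<subseteq> G \<and> size1 t = n}"

definition free_operad :: "'g set \<Rightarrow> ('k::field, 'g tree \<Rightarrow>\<^sub>0 'k) operad" where
  "free_operad G = linear_operad (syntax_trees G) (\<lambda>n m i t s. graft t i s) Leaf"

definition corolla :: "'g \<Rightarrow> 'g tree \<Rightarrow>\<^sub>0 'k::field" where
  "corolla g = Poly_Mapping.single (Node Leaf g Leaf) 1"


section \<open>Decorated cliques\<close>

locale unitary_magma =
  fixes star :: "'m \<Rightarrow> 'm \<Rightarrow> 'm" and one :: 'm
  assumes left_unit: "star one a = a"
    and right_unit: "star a one = a"

definition arcs :: "nat \<Rightarrow> (nat \<times> nat) set" where
  "arcs n = {(x, y). 1 \<le> x \<and> x < y \<and> y \<le> n + 1}"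

definition diagonals :: "nat \<Rightarrow> (nat \<times> nat) set" where
  "diagonals n = arcs n - {(1, n + 1)} - {(i, i + 1) | i. i \<in> {1..n}}"

type_synonym 'm clique = "nat \<times> nat \<Rightarrow> 'm"

text \<open>The only clique of arity 1 is the one whose unique arc is labelled by the unit.\<close>

definition cliques :: "'m \<Rightarrow> nat \<Rightarrow> 'm clique set" where
  "cliques one n = {p \<in> arcs n \<rightarrow>\<^sub>E UNIV. 1 \<le> n \<and> (n = 1 \<longrightarrow> p (1, 2) = one)}"

definition unit_clique :: "'m \<Rightarrow> 'm clique" where
  "unit_clique one = (\<lambda>a\<in>arcs 1. one)"

definition crossing :: "nat \<times> nat \<Rightarrow> nat \<times> nat \<Rightarrow> bool" where
  "crossing = (\<lambda>(x, y) (x', y'). x < x' \<and> x' < y \<and> y < y' \<or> x' < x \<and> x < y' \<and> y' < y)"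

definition noncrossing_cliques :: "'m \<Rightarrow> nat \<Rightarrow> 'm clique set" where
  "noncrossing_cliques one n =
     {p \<in> cliques one n. \<forall>d\<in>diagonals n. \<forall>d'\<in>diagonals n.
        p d \<noteq> one \<longrightarrow> p d' \<noteq> one \<longrightarrow> \<not> crossing d d'}"

text \<open>
  The renumbering of the vertices of \<open>p\<close> is \<open>vshift m i\<close>; its image is the set of all \<open>v\<close> with
  \<open>v \<le> i\<close> or \<open>i + m \<le> v\<close>, and \<open>vunshift m i\<close> is its inverse there. The composition is defined by
  cases on the arc of the result; the lemmas below restate it in terms of the arcs of
  \<open>p\<close> and \<open>q\<close>.
\<close>

definition vshift :: "nat \<Rightarrow> nat \<Rightarrow> nat \<Rightarrow> nat" where
  "vshift m i x = (if x \<le> i then x else x + m - 1)"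

definition vunshift :: "nat \<Rightarrow> nat \<Rightarrow> nat \<Rightarrow> nat" where
  "vunshift m i v = (if v \<le> i then v else v + 1 - m)"

definition clique_comp ::
    "('m \<Rightarrow> 'm \<Rightarrow> 'm) \<Rightarrow> 'm \<Rightarrow> nat \<Rightarrow> nat \<Rightarrow> nat \<Rightarrow> 'm clique \<Rightarrow> 'm clique \<Rightarrow> 'm clique" where
  "clique_comp star one n m i p q =
     (\<lambda>(u, v)\<in>arcs (n + m - 1).
        if (u, v) = (i, i + m) then star (p (i, i + 1)) (q (1, m + 1))
        else if (u \<le> i \<or> i + m \<le> u) \<and> (v \<le> i \<or> i + m \<le> v)
          then p (vunshift m i u, vunshift m i v)
        else if i \<le> u \<and> v \<le> i + m then q (u + 1 - i, v + 1 - i)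
        else one)"

lemma clique_comp_base:
  assumes "i \<in> {1..n}" "1 \<le> m"
  shows "clique_comp star one n m i p q (i, i + m) = star (p (i, i + 1)) (q (1, m + 1))"
proof -
  have "(i, i + m) \<in> arcs (n + m - 1)" using assms by (simp add: arcs_def)
  then show ?thesis by (simp add: clique_comp_def)
qed

lemma clique_comp_left:
  assumes "i \<in> {1..n}" "1 \<le> m" "(x, y) \<in> arcs n" "(x, y) \<noteq> (i, i + 1)"
  shows "clique_comp star one n m i p q (vshift m i x, vshift m i y) = p (x, y)"
proof -
  have xy: "1 \<le> x" "x < y" "y \<le> n + 1" using assms(3) by (simp_all add: arcs_def)
  have im: "1 \<le> i" "i \<le> n" using assms(1) by simp_all
  have eq: "vshift m i v = v \<and> v \<le> i \<or> vshift m i v = v + m - 1 \<and> i < v" for v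
    by (simp add: vshift_def)
  have inv: "vunshift m i (vshift m i v) = v" "vshift m i v \<le> i \<or> i + m \<le> vshift m i v" for v
    using eq[of v] assms(2) by (auto simp: vunshift_def)
  have arc: "(vshift m i x, vshift m i y) \<in> arcs (n + m - 1)"
    using eq[of x] eq[of y] xy im assms(2) unfolding arcs_def mem_Collect_eq case_prod_conv by linarith
  have "(vshift m i x, vshift m i y) \<noteq> (i, i + m)"
  proof
    assume "(vshift m i x, vshift m i y) = (i, i + m)"
    then have "vshift m i x = i" "vshift m i y = i + m" by simp_all
    then have "x = i" "y = i + 1"
      using eq[of x] eq[of y] assms(2) by auto
    then show False using assms(4) by simp
  qed
  then show ?thesis using arc inv[of x] inv[of y]
    unfolding clique_comp_def by (simp only: restrict_apply' case_prod_conv simp_thms if_True if_False)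
qed

lemma clique_comp_right:
  assumes "i \<in> {1..n}" "1 \<le> m" "(x, y) \<in> arcs m" "(x, y) \<noteq> (1, m + 1)"
  shows "clique_comp star one n m i p q (x + i - 1, y + i - 1) = q (x, y)"
proof -
  have xy: "1 \<le> x" "x < y" "y \<le> m + 1" using assms(3) by (simp_all add: arcs_def)
  have im: "1 \<le> i" "i \<le> n" using assms(1) by simp_all
  have ne: "\<not> (x = 1 \<and> y = m + 1)" using assms(4) by simp
  have arc: "(x + i - 1, y + i - 1) \<in> arcs (n + m - 1)"
    using xy im unfolding arcs_def mem_Collect_eq case_prod_conv by linarith
  define u v where u_v_def: "u = x + i - 1" "v = y + i - 1"
  have "\<not> ((u \<le> i \<or> i + m \<le> u) \<and> (v \<le> i \<or> i + m \<le> v))"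
    using ne xy im unfolding u_v_def by linarith
  moreover from this have "(u, v) \<noteq> (i, i + m)" by auto
  moreover have "i \<le> u \<and> v \<le> i + m" "u + 1 - i = x" "v + 1 - i = y"
    using xy im unfolding u_v_def by linarith+
  moreover have "(u, v) \<in> arcs (n + m - 1)" using arc by (simp only: u_v_def)
  ultimately have "clique_comp star one n m i p q (u, v) = q (x, y)"
    unfolding clique_comp_def by (simp only: restrict_apply' case_prod_conv simp_thms if_True if_False)
  then show ?thesis by (simp only: u_v_def)
qed

lemma clique_comp_other:
  assumes "i \<in> {1..n}" "1 \<le> m" "a \<in> arcs (n + m - 1)"
    and "a \<notin> (\<lambda>(x, y). (vshift m i x, vshift m i y)) ` arcs n"
    and "a \<notin> (\<lambda>(x, y). (x + i - 1, y + i - 1)) ` arcs m"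
  shows "clique_comp star one n m i p q a = one"
proof -
  obtain u v where a: "a = (u, v)" by (cases a)
  have uv: "1 \<le> u" "u < v" "v \<le> n + m" using assms(1-3) by (auto simp: a arcs_def)
  have 1: "\<not> ((u \<le> i \<or> i + m \<le> u) \<and> (v \<le> i \<or> i + m \<le> v))"
  proof
    assume h: "(u \<le> i \<or> i + m \<le> u) \<and> (v \<le> i \<or> i + m \<le> v)"
    have im: "1 \<le> i" "i \<le> n" using assms(1) by simp_all
    define x y where xy_def: "x = vunshift m i u" "y = vunshift m i v"
    have eq: "x = u \<and> u \<le> i \<or> x + m = u + 1 \<and> i + m \<le> u"
      "y = v \<and> v \<le> i \<or> y + m = v + 1 \<and> i + m \<le> v"
      using h assms(2) by (auto simp: xy_def vunshift_def)
    have "vshift m i x = u" "vshift m i y = v"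
      using eq by (auto simp: vshift_def)
    moreover have "(x, y) \<in> arcs n"
      using eq uv im unfolding arcs_def mem_Collect_eq case_prod_conv by linarith
    ultimately show False using assms(4) unfolding a by (metis (no_types, lifting) case_prod_conv image_eqI)
  qed
  have 2: "\<not> (i \<le> u \<and> v \<le> i + m)"
  proof
    assume h: "i \<le> u \<and> v \<le> i + m"
    have im: "1 \<le> i" "i \<le> n" using assms(1) by simp_all
    have "(u + 1 - i, v + 1 - i) \<in> arcs m"
      using h uv im unfolding arcs_def mem_Collect_eq case_prod_conv by linarith
    moreover have "u + 1 - i + i - 1 = u" "v + 1 - i + i - 1 = v"
      using h uv im by linarith+
    ultimately show False using assms(5) unfolding a by (metis (no_types, lifting) case_prod_conv image_eqI)
  qed
  show ?thesis using 1 2 assms(3) by (auto simp: clique_comp_def a)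
qed

definition clique_operad ::
    "('m \<Rightarrow> 'm \<Rightarrow> 'm) \<Rightarrow> 'm \<Rightarrow> ('k::field, 'm clique \<Rightarrow>\<^sub>0 'k) operad" where
  "clique_operad star one = linear_operad (cliques one) (clique_comp star one) (unit_clique one)"

definition NC_operad ::
    "('m \<Rightarrow> 'm \<Rightarrow> 'm) \<Rightarrow> 'm \<Rightarrow> ('k::field, 'm clique \<Rightarrow>\<^sub>0 'k) operad" where
  "NC_operad star one =
     clique_operad star one \<lparr> component := \<lambda>n. {f. Poly_Mapping.keys f \<subseteq> noncrossing_cliques one n} \<rparr>"


section \<open>The quadratic relations between triangles\<close>

abbreviation triangles :: "'m \<Rightarrow> 'm clique set" where
  "triangles one \<equiv> cliques one 2"

definition triangle :: "'m \<Rightarrow> 'm \<Rightarrow> 'm \<Rightarrow> 'm clique" where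
  "triangle a b c = (\<lambda>d\<in>arcs 2. if d = (1, 3) then a else if d = (1, 2) then b else c)"

lemma triangles_eq: "triangles one = {triangle a b c | a b c. True}"
proof -
  have arcs2: "arcs 2 = {(1, 3), (1, 2), (2, 3)}" by (auto simp: arcs_def)
  have "p = triangle (p (1, 3)) (p (1, 2)) (p (2, 3))" if "p \<in> triangles one" for p :: "'a clique"
  proof (rule ext)
    fix d
    show "p d = triangle (p (1, 3)) (p (1, 2)) (p (2, 3)) d"
    proof (cases "d \<in> arcs 2")
      case True
      then show ?thesis by (auto simp: triangle_def arcs2)
    next
      case False
      moreover have "p d = undefined"
        using that False by (auto simp: cliques_def intro: PiE_arb)
      ultimately show ?thesis by (simp only: triangle_def restrict_def if_False)
    qed
  qed
  moreover have "triangle a b c \<in> triangles one" for a b c :: 'a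
    by (simp add: cliques_def triangle_def)
  ultimately show ?thesis by blast
qed

text \<open>The degree-2 syntax tree with root \<open>s\<close> and \<open>t\<close> grafted onto its \<open>i\<close>-th input.\<close>

definition tree2 :: "'m \<Rightarrow> nat \<Rightarrow> 'm clique \<Rightarrow> 'm clique \<Rightarrow> 'm clique tree \<Rightarrow>\<^sub>0 'k::field" where
  "tree2 one i s t = pcomp (free_operad (triangles one)) 2 2 i (corolla s) (corolla t)"

lemma tree2_eq:
  "tree2 one 1 s t = Poly_Mapping.single (Node (Node Leaf t Leaf) s Leaf) 1"
  "tree2 one 2 s t = Poly_Mapping.single (Node Leaf s (Node Leaf t Leaf)) 1"
  by (simp_all add: tree2_def free_operad_def linear_operad_def corolla_def)

definition NC_relators ::
    "('m \<Rightarrow> 'm \<Rightarrow> 'm) \<Rightarrow> 'm \<Rightarrow> ('m clique tree \<Rightarrow>\<^sub>0 'k::field) set" where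
  "NC_relators star one =
     {tree2 one 1 (triangle p0 p1 p2) (triangle q0 q1 q2)
        - tree2 one 1 (triangle p0 r1 p2) (triangle r0 q1 q2) | p0 p1 p2 q0 q1 q2 r0 r1.
      star p1 q0 = star r1 r0 \<and> star r1 r0 \<noteq> one} \<union>
     {tree2 one 1 (triangle p0 p1 p2) (triangle q0 q1 q2)
        - tree2 one 2 (triangle p0 q1 r2) (triangle r0 q2 p2) | p0 p1 p2 q0 q1 q2 r0 r2.
      star p1 q0 = star r2 r0 \<and> star r2 r0 = one} \<union>
     {tree2 one 2 (triangle p0 p1 p2) (triangle q0 q1 q2)
        - tree2 one 2 (triangle p0 p1 r2) (triangle r0 q1 q2) | p0 p1 p2 q0 q1 q2 r0 r2.
      star p2 q0 = star r2 r0 \<and> star r2 r0 \<noteq> one}"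

text \<open>A graded family of subspaces, concentrated in arity 3.\<close>

definition NC_relations ::
    "('m \<Rightarrow> 'm \<Rightarrow> 'm) \<Rightarrow> 'm \<Rightarrow> nat \<Rightarrow> ('m clique tree \<Rightarrow>\<^sub>0 'k::field) set" where
  "NC_relations star one n = (if n = 3 then formal.span (NC_relators star one) else {0})"

end

theory Submission
  imports Defs
begin

text \<open>
  Evaluating a syntax tree in the operad of noncrossing cliques amounts to drawing, for each
  internal node, an arc of the polygon; the tree is a triangulation whose diagonals carry the
  product of the two labels glued there. Any triangulation compatible with the solid diagonals of a
  noncrossing clique arises in this way, so evaluation is surjective, and its kernel is spanned by
  differences of trees with equal evaluations. Such trees are related by the relations: if their
  roots split the polygon at the same vertex, the factors of the labels next to the root can be
  matched and one concludes by induction on the arity. If the roots split at distinct vertices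
  \<open>k < k'\<close>, then the diagonal from \<open>k\<close> to the last vertex crosses the one from \<open>1\<close> to \<open>k'\<close>, hence
  has label \<open>1\<close>; by induction the right subtree of the first tree may be assumed to split at \<open>k'\<close>,
  and relation (2) then moves the split of the root to \<open>k'\<close>.
\<close>

section \<open>Linear and bilinear extensions\<close>

definition lin :: "('a \<Rightarrow> 'b) \<Rightarrow> ('a \<Rightarrow>\<^sub>0 'k::field) \<Rightarrow> ('b \<Rightarrow>\<^sub>0 'k)" where
  "lin h f = (\<Sum>x\<in>Poly_Mapping.keys f. Poly_Mapping.single (h x) (Poly_Mapping.lookup f x))"

text \<open>The body repeats \<open>pcomp\<close> of \<open>linear_operad\<close>, so the
  compositions of both operads unfold to instances of \<open>bilin\<close>.\<close>

definition bilin :: "('a \<Rightarrow> 'b \<Rightarrow> 'c) \<Rightarrow> ('a \<Rightarrow>\<^sub>0 'k::field) \<Rightarrow> ('b \<Rightarrow>\<^sub>0 'k) \<Rightarrow> ('c \<Rightarrow>\<^sub>0 'k)" where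
  "bilin c f g = (\<Sum>x\<in>Poly_Mapping.keys f. \<Sum>y\<in>Poly_Mapping.keys g.
     Poly_Mapping.single (c x y) (Poly_Mapping.lookup f x * Poly_Mapping.lookup g y))"

lemma lookup_not_keys: "x \<notin> Poly_Mapping.keys f \<Longrightarrow> Poly_Mapping.lookup f x = 0"
  by (simp add: in_keys_iff)

text \<open>Because of cancellation the support of a sum can be smaller than the union of the
  supports. Summing over any finite superset gives all terms one index set, and additivity becomes
  termwise.\<close>

lemma lin_superset:
  assumes "finite S" "Poly_Mapping.keys f \<subseteq> S"
  shows "lin h f = (\<Sum>x\<in>S. Poly_Mapping.single (h x) (Poly_Mapping.lookup f x))"
  unfolding lin_def using assms by (intro sum.mono_neutral_left) (auto simp: lookup_not_keys)

lemma bilin_superset: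
  assumes "finite S" "Poly_Mapping.keys f \<subseteq> S" "finite T" "Poly_Mapping.keys g \<subseteq> T"
  shows "bilin c f g = (\<Sum>x\<in>S. \<Sum>y\<in>T.
     Poly_Mapping.single (c x y) (Poly_Mapping.lookup f x * Poly_Mapping.lookup g y))"
proof -
  have "bilin c f g = (\<Sum>x\<in>Poly_Mapping.keys f. \<Sum>y\<in>T.
     Poly_Mapping.single (c x y) (Poly_Mapping.lookup f x * Poly_Mapping.lookup g y))"
    unfolding bilin_def using assms
    by (intro sum.cong refl sum.mono_neutral_left) (auto simp: lookup_not_keys)
  also have "\<dots> = (\<Sum>x\<in>S. \<Sum>y\<in>T.
     Poly_Mapping.single (c x y) (Poly_Mapping.lookup f x * Poly_Mapping.lookup g y))"
    using assms by (intro sum.mono_neutral_left) (auto simp: lookup_not_keys)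
  finally show ?thesis .
qed

lemma single_scale: "Poly_Mapping.single x (a * b) = fscale a (Poly_Mapping.single x b)"
  by (rule poly_mapping_eqI) (simp add: lookup_single when_def)

lemma keys_fscale: "Poly_Mapping.keys (fscale a f) \<subseteq> Poly_Mapping.keys f"
  by (auto simp: in_keys_iff)

lemma fscale_minus_one: "fscale (- 1) f = - f"
  by (rule poly_mapping_eqI) simp

lemma lin_zero [simp]: "lin h 0 = 0"
  by (simp add: lin_def)

lemma lin_single [simp]: "lin h (Poly_Mapping.single x a) = Poly_Mapping.single (h x) a"
  by (subst lin_superset[of "{x}"]) simp_all

lemma lin_add: "lin h (f + g) = lin h f + lin h g"
proof -
  let ?S = "Poly_Mapping.keys f \<union> Poly_Mapping.keys g"
  have "Poly_Mapping.keys (f + g) \<subseteq> ?S" by (rule keys_add)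
  then show ?thesis
    by (simp add: lin_superset[of ?S] lookup_add single_add sum.distrib)
qed

lemma lin_fscale: "lin h (fscale a f) = fscale a (lin h f)"
  by (simp add: lin_superset[OF _ keys_fscale[of a f]] lin_def[of h f] single_scale formal.scale_sum_right)

lemma lin_diff: "lin h (f - g) = lin h f - lin h g"
  using lin_add[of h "f - g" g] by simp

lemma lin_sum: "lin h (sum F S) = (\<Sum>x\<in>S. lin h (F x))"
  by (induction S rule: infinite_finite_induct) (simp_all add: lin_add)

lemma lin_comp: "lin h (lin g f) = lin (h \<circ> g) f"
  unfolding lin_def[of g] by (simp add: lin_sum lin_def[of "h \<circ> g"])

lemma lin_cong: "(\<And>x. x \<in> Poly_Mapping.keys f \<Longrightarrow> h x = g x) \<Longrightarrow> lin h f = lin g f"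
  unfolding lin_def by (rule sum.cong) simp_all

lemma lin_id: "lin (\<lambda>x. x) f = f"
  by (rule poly_mapping_eqI)
    (simp add: lin_def lookup_sum lookup_single when_def sum.delta lookup_not_keys)

lemma keys_lin: "Poly_Mapping.keys (lin h f) \<subseteq> h ` Poly_Mapping.keys f"
  unfolding lin_def using keys_sum by (fastforce split: if_splits)

lemma keys_bilin:
  "Poly_Mapping.keys (bilin c f g) \<subseteq> {c x y | x y. x \<in> Poly_Mapping.keys f \<and> y \<in> Poly_Mapping.keys g}"
proof -
  have "Poly_Mapping.keys (bilin c f g) \<subseteq> (\<Union>x\<in>Poly_Mapping.keys f. \<Union>y\<in>Poly_Mapping.keys g. {c x y})"
    unfolding bilin_def
    by (rule order_trans[OF keys_sum] UN_mono subset_refl)+ simp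
  then show ?thesis by blast
qed

lemma bilin_single: "bilin c (Poly_Mapping.single x a) (Poly_Mapping.single y b) = Poly_Mapping.single (c x y) (a * b)"
  by (subst bilin_superset[of "{x}" _ "{y}"]) simp_all

lemma bilin_zero [simp]: "bilin c 0 g = 0" "bilin c f 0 = 0"
  by (simp_all add: bilin_def)

lemma bilin_add_left: "bilin c (f + f') g = bilin c f g + bilin c f' g"
proof -
  let ?S = "Poly_Mapping.keys f \<union> Poly_Mapping.keys f'"
  have "Poly_Mapping.keys (f + f') \<subseteq> ?S" by (rule keys_add)
  then show ?thesis
    by (simp add: bilin_superset[of ?S _ "Poly_Mapping.keys g"] lookup_add distrib_right single_add sum.distrib)
qed

lemma bilin_add_right: "bilin c f (g + g') = bilin c f g + bilin c f g'"
proof -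
  let ?S = "Poly_Mapping.keys g \<union> Poly_Mapping.keys g'"
  have "Poly_Mapping.keys (g + g') \<subseteq> ?S" by (rule keys_add)
  then show ?thesis
    by (simp add: bilin_superset[of "Poly_Mapping.keys f" _ ?S] lookup_add distrib_left single_add sum.distrib)
qed

lemma bilin_diff_left: "bilin c (f - f') g = bilin c f g - bilin c f' g"
  using bilin_add_left[of c "f - f'" f' g] by simp

lemma bilin_diff_right: "bilin c f (g - g') = bilin c f g - bilin c f g'"
  using bilin_add_right[of c f "g - g'" g'] by simp

lemma bilin_sum_left: "bilin c (sum F S) g = (\<Sum>x\<in>S. bilin c (F x) g)"
  by (induction S rule: infinite_finite_induct) (simp_all add: bilin_add_left)

lemma bilin_sum_right: "bilin c f (sum G S) = (\<Sum>x\<in>S. bilin c f (G x))"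
  by (induction S rule: infinite_finite_induct) (simp_all add: bilin_add_right)

text \<open>The hypothesis is asked only on the supports, because evaluation turns
  \<open>graft\<close> into \<open>clique_comp star one n m i\<close> only for trees of arities
  \<open>n\<close> and \<open>m\<close>.\<close>

lemma lin_bilin:
  assumes "\<And>x y. x \<in> Poly_Mapping.keys f \<Longrightarrow> y \<in> Poly_Mapping.keys g \<Longrightarrow> h (c x y) = c' (h x) (h y)"
  shows "lin h (bilin c f g) = bilin c' (lin h f) (lin h g)"
  unfolding bilin_def[of c] lin_def[of h f] lin_def[of h g] bilin_sum_left
  by (simp add: lin_sum bilin_sum_right bilin_single assms)

section \<open>Quotient operads\<close>

text \<open>The inverse isomorphism sends an element of \<open>Q\<close> to its fibre, which is a coset.\<close>

lemma quotient_operad_isomorphic: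
  fixes P :: "('k, 'v) operad" and Q :: "('k, 'w) operad"
  assumes hom: "operad_hom P Q f"
    and surj: "\<And>n. f n ` component P n = component Q n"
    and coset: "\<And>n x. x \<in> component P n \<Longrightarrow> coset P I n x = {y \<in> component P n. f n y = f n x}"
    and add: "\<And>n x y. x \<in> component P n \<Longrightarrow> y \<in> component P n \<Longrightarrow> vadd P n x y \<in> component P n"
    and scale: "\<And>n c x. x \<in> component P n \<Longrightarrow> vscale P n c x \<in> component P n"
    and pcomp: "\<And>n m i x y. x \<in> component P n \<Longrightarrow> y \<in> component P m \<Longrightarrow> 1 \<le> i \<Longrightarrow> i \<le> n \<Longrightarrow> 1 \<le> m \<Longrightarrow>
      pcomp P n m i x y \<in> component P (n + m - 1)"
    and unit: "ounit P \<in> component P 1"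
  shows "operad_isomorphic Q (quotient_operad P I)"
proof -
  define g where "g n z = {y \<in> component P n. f n y = z}" for n z
  have cos: "coset P I n x = g n (f n x)" if "x \<in> component P n" for n x
    using coset[OF that] by (simp add: g_def)
  \<comment> \<open>The operations of \<open>quotient_operad\<close> are unions over
    representatives. The sets united all coincide, but the union equals their common value only if
    there is at least one representative.\<close>
  have ne: "g n z \<noteq> {}" if "z \<in> component Q n" for n z
  proof -
    have "z \<in> f n ` component P n" using that by (simp only: surj)
    then show ?thesis by (auto simp: g_def)
  qed
  note h = hom[unfolded operad_hom_def]
  have comp: "component (quotient_operad P I) n = g n ` component Q n" for n
    unfolding quotient_operad_def surj[symmetric] image_image by (simp add: cos)
  have "operad_hom Q (quotient_operad P I) g"
    unfolding operad_hom_def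
  proof (intro conjI allI ballI impI)
    show "g n \<in> component Q n \<rightarrow> component (quotient_operad P I) n" for n
      by (simp add: comp)
  next
    fix n x y assume xy: "x \<in> component Q n" "y \<in> component Q n"
    have "coset P I n (vadd P n a b) = g n (vadd Q n x y)" if "a \<in> g n x" "b \<in> g n y" for a b
      using that add h by (auto simp: g_def cos)
    then show "g n (vadd Q n x y) = vadd (quotient_operad P I) n (g n x) (g n y)"
      using ne[OF xy(1)] ne[OF xy(2)] by (simp add: quotient_operad_def)
  next
    fix n c x assume x: "x \<in> component Q n"
    have "coset P I n (vscale P n c a) = g n (vscale Q n c x)" if "a \<in> g n x" for a
      using that scale h by (auto simp: g_def cos)
    then show "g n (vscale Q n c x) = vscale (quotient_operad P I) n c (g n x)"
      using ne[OF x] by (simp add: quotient_operad_def)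
  next
    show "g 1 (ounit Q) = ounit (quotient_operad P I)"
      using h unit cos[of "ounit P" 1] by (simp add: quotient_operad_def)
  next
    fix n m i x y assume i: "i \<in> {1..n}" and xy: "x \<in> component Q n" "y \<in> component Q m" and m: "1 \<le> m"
    have "coset P I (n + m - 1) (pcomp P n m i a b) = g (n + m - 1) (pcomp Q n m i x y)"
      if "a \<in> g n x" "b \<in> g m y" for a b
    proof -
      have ab: "a \<in> component P n" "b \<in> component P m" "f n a = x" "f m b = y"
        using that by (auto simp: g_def)
      then have "f (n + m - 1) (pcomp P n m i a b) = pcomp Q n m i x y"
        using h i m by blast
      then show ?thesis using cos[OF pcomp[OF ab(1,2), of i]] i m by simp
    qed
    then show "g (n + m - 1) (pcomp Q n m i x y) = pcomp (quotient_operad P I) n m i (g n x) (g m y)"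
      using ne[OF xy(1)] ne[OF xy(2)] by (simp add: quotient_operad_def)
  qed
  moreover have "bij_betw (g n) (component Q n) (component (quotient_operad P I) n)" for n
    unfolding bij_betw_def comp
  proof (intro conjI inj_onI refl)
    fix x y assume "x \<in> component Q n" "y \<in> component Q n" "g n x = g n y"
    then show "x = y" using ne[of x n] by (auto simp: g_def)
  qed
  ultimately show ?thesis unfolding operad_isomorphic_def by blast
qed

section \<open>Evaluation of syntax trees\<close>

lemma triangle_simps [simp]:
  "triangle a b c (Suc 0, 3) = a" "triangle a b c (Suc 0, 2) = b" "triangle a b c (2, 3) = c"
  by (simp_all add: triangle_def arcs_def)

lemma triangle_in_triangles [simp]: "triangle a b c \<in> triangles one"
  unfolding triangles_eq by blast

lemma triangle_cases:
  assumes "g \<in> triangles one"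
  obtains a b c where "g = triangle a b c"
  using assms unfolding triangles_eq by blast

text \<open>Labels are kept as total curried functions, so that shifts of vertices need no care
  about domains; only the values on arcs are compared.\<close>

definition same_labels :: "nat \<Rightarrow> (nat \<Rightarrow> nat \<Rightarrow> 'm) \<Rightarrow> (nat \<Rightarrow> nat \<Rightarrow> 'm) \<Rightarrow> bool" where
  "same_labels n p q \<longleftrightarrow> (\<forall>x y. 1 \<le> x \<longrightarrow> x < y \<longrightarrow> y \<le> n + 1 \<longrightarrow> p x y = q x y)"

lemma same_labels_refl [simp]: "same_labels n p p"
  and same_labels_sym: "same_labels n p q \<Longrightarrow> same_labels n q p"
  and same_labels_trans: "same_labels n p q \<Longrightarrow> same_labels n q r \<Longrightarrow> same_labels n p r"
  by (simp_all add: same_labels_def)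

lemma same_labelsD: "same_labels n p q \<Longrightarrow> 1 \<le> x \<Longrightarrow> x < y \<Longrightarrow> y \<le> n + 1 \<Longrightarrow> p x y = q x y"
  by (simp add: same_labels_def)

text \<open>Gluing a subtree to its parent multiplies its base label by an edge label of the parent
  and leaves its other labels visible. Equality away from the base is therefore what the labels of
  the whole tree reveal.\<close>

definition same_inner_labels :: "nat \<Rightarrow> (nat \<Rightarrow> nat \<Rightarrow> 'm) \<Rightarrow> (nat \<Rightarrow> nat \<Rightarrow> 'm) \<Rightarrow> bool" where
  "same_inner_labels n p q \<longleftrightarrow>
     (\<forall>x y. 1 \<le> x \<longrightarrow> x < y \<longrightarrow> y \<le> n + 1 \<longrightarrow> (x, y) \<noteq> (1, n + 1) \<longrightarrow> p x y = q x y)"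

lemma same_inner_labels_refl [simp]: "same_inner_labels n p p"
  by (simp add: same_inner_labels_def)

lemma same_inner_labelsD: "same_inner_labels n p q \<Longrightarrow> 1 \<le> x \<Longrightarrow> x < y \<Longrightarrow> y \<le> n + 1 \<Longrightarrow>
    (x, y) \<noteq> (1, n + 1) \<Longrightarrow> p x y = q x y"
  by (simp add: same_inner_labels_def)

lemma same_labels_iff_inner:
  "1 \<le> n \<Longrightarrow> same_labels n p q \<longleftrightarrow> p 1 (n + 1) = q 1 (n + 1) \<and> same_inner_labels n p q"
  by (auto simp: same_labels_def same_inner_labels_def)

section \<open>Labels of the arcs drawn by a syntax tree\<close>

context unitary_magma
begin

text \<open>The root draws a triangle on the base with apex at vertex \<open>size1 l + 1\<close>.
  The left subtree lives on the vertices up to the apex, the right one on those from the apex on,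
  and every arc over the apex except the base is trivial. A leaf contributes \<open>one\<close>, so
  an edge of the root triangle that ends in a leaf keeps its own label by
  \<open>right_unit\<close>.\<close>

fun lab :: "'m clique tree \<Rightarrow> nat \<Rightarrow> nat \<Rightarrow> 'm" where
  "lab Leaf x y = one"
| "lab (Node l g r) x y =
     (if x = 1 \<and> y = size1 l + size1 r + 1 then g (1, 3)
      else if y \<le> size1 l + 1 then
        (if x = 1 \<and> y = size1 l + 1 then star (g (1, 2)) (lab l x y) else lab l x y)
      else if size1 l + 1 \<le> x then
        (if x = size1 l + 1 \<and> y = size1 l + size1 r + 1
         then star (g (2, 3)) (lab r 1 (size1 r + 1)) else lab r (x - size1 l) (y - size1 l))
      else one)"

definition evaluation :: "'m clique tree \<Rightarrow> 'm clique" where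
  "evaluation t = (\<lambda>(x, y)\<in>arcs (size1 t). lab t x y)"

abbreviation base :: "'m clique tree \<Rightarrow> 'm" where
  "base t \<equiv> lab t 1 (size1 t + 1)"

lemma Suc_0_le_size1 [simp]: "Suc 0 \<le> size1 t"
  by (simp add: Suc_le_eq)

lemma size1_neq_0 [simp]: "size1 t \<noteq> 0"
  using size1_ge0[of t] by simp

lemma size1_1_iff: "size1 t = Suc 0 \<longleftrightarrow> t = Leaf"
  by (cases t) (simp_all add: add_is_1)

lemma lab_Node_base: "x = 1 \<Longrightarrow> y = size1 l + size1 r + 1 \<Longrightarrow> lab (Node l g r) x y = g (1, 3)"
  by simp

lemma lab_Node_left:
  "y \<le> size1 l + 1 \<Longrightarrow> lab (Node l g r) x y =
    (if x = 1 \<and> y = size1 l + 1 then star (g (1, 2)) (base l) else lab l x y)"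
  by auto

lemma lab_Node_right:
  "size1 l + 1 \<le> x \<Longrightarrow> x < y \<Longrightarrow> lab (Node l g r) x y =
    (if x = size1 l + 1 \<and> y = size1 l + size1 r + 1 then star (g (2, 3)) (base r)
     else lab r (x - size1 l) (y - size1 l))"
  by auto

lemma lab_Node_cross:
  "x < size1 l + 1 \<Longrightarrow> size1 l + 1 < y \<Longrightarrow> (x, y) \<noteq> (1, size1 l + size1 r + 1) \<Longrightarrow>
    lab (Node l g r) x y = one"
  by auto

lemmas lab_Node = lab_Node_base lab_Node_left lab_Node_right lab_Node_cross

declare lab.simps(2) [simp del]

lemma size1_graft: "1 \<le> i \<Longrightarrow> i \<le> size1 t \<Longrightarrow> size1 (graft t i s) = size1 t + size1 s - 1"
proof (induction t arbitrary: i)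
  case (Node l g r)
  have "size1 l \<ge> 1" "size1 r \<ge> 1" "size1 s \<ge> 1" by simp_all
  with Node show ?case by auto
qed simp

text \<open>The right-hand side is the case distinction of \<open>clique_comp\<close>; the induction
  descends to the subtree that contains leaf \<open>i\<close>. As \<open>star\<close> is not assumed
  associative, no triple product may arise: the glued edge sits at a leaf, whose own label is
  \<open>one\<close>, and the unit laws absorb it.\<close>

lemma lab_graft:
  assumes "1 \<le> i" "i \<le> size1 t" "1 \<le> x" "x < y" "y \<le> size1 t + size1 s"
  shows "lab (graft t i s) x y =
    (if x = i \<and> y = i + size1 s then star (lab t i (i + 1)) (lab s 1 (size1 s + 1))
     else if (x \<le> i \<or> i + size1 s \<le> x) \<and> (y \<le> i \<or> i + size1 s \<le> y)
       then lab t (vunshift (size1 s) i x) (vunshift (size1 s) i y)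
     else if i \<le> x \<and> y \<le> i + size1 s then lab s (x + 1 - i) (y + 1 - i)
     else one)"
  using assms
proof (induction t arbitrary: i x y)
  case Leaf
  then show ?case by (auto simp: left_unit)
next
  case (Node l g r)
  define N R S where sizes: "N = size1 l" "R = size1 r" "S = size1 s"
  note sizes' = sizes [symmetric]
  have pos: "1 \<le> N" "1 \<le> R" "1 \<le> S" by (simp_all add: sizes)
  have xy: "1 \<le> i" "i \<le> N + R" "1 \<le> x" "x < y" "y \<le> N + R + S"
    using Node.prems by (simp_all add: sizes)
  note IH = Node.IH[unfolded sizes']
  show ?case
  proof (cases "i \<le> N")
    case i: True
    define l' where "l' = graft l i s"
    have sz: "size1 l' = N + S - 1"
      using size1_graft[of i l s] i xy by (simp add: sizes l'_def)
    have graft: "graft (Node l g r) i s = Node l' g r" using i by (simp add: sizes l'_def)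
    \<comment> \<open>Grafting into the left subtree moves the apex of the root from
      \<open>N + 1\<close> to \<open>N + S\<close>; the regions are taken relative to the new
      apex.\<close>
    consider (base) "x = 1" "y = N + R + S" | (left) "y \<le> N + S" | (right) "N + S \<le> x"
      | (cross) "x < N + S" "N + S < y" "\<not> (x = 1 \<and> y = N + R + S)" by linarith
    then show ?thesis
    proof cases
      case base
      then show ?thesis unfolding graft using xy pos i sz by (simp add: lab_Node vunshift_def sizes')
    next
      case left
      have l': "lab l' x y = (if x = i \<and> y = i + S then star (lab l i (i + 1)) (base s)
         else if (x \<le> i \<or> i + S \<le> x) \<and> (y \<le> i \<or> i + S \<le> y) then lab l (vunshift S i x) (vunshift S i y)
         else if i \<le> x \<and> y \<le> i + S then lab s (x + 1 - i) (y + 1 - i) else one)"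
        unfolding l'_def using IH(1)[of i x y] xy left i by (simp add: sizes')
      show ?thesis
      proof (cases "x = 1 \<and> y = N + S")
        case True
        show ?thesis
        proof (cases "i = 1 \<and> N = 1")
          \<comment> \<open>The leaf is the left child of the root itself, so the base label of
            \<open>s\<close> is multiplied directly by \<open>g (1, 2)\<close>; both sides are this
            product.\<close>
          case t: True
          then have "l = Leaf" using size1_1_iff[of l] by (simp add: sizes)
          then show ?thesis unfolding graft using True t l' sz
            by (simp add: lab_Node sizes' left_unit right_unit)
        next
          case False
          then show ?thesis unfolding graft using True l' sz xy i pos
            by (auto simp: lab_Node sizes' vunshift_def)
        qed
      next
        case False
        have "vunshift S i x \<noteq> 1 \<or> vunshift S i y \<noteq> N + 1"
           "vunshift S i y \<le> N + 1" "\<not> (x = i \<and> y = i + S \<and> i = 1 \<and> N = 1)"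
          if "(x \<le> i \<or> i + S \<le> x) \<and> (y \<le> i \<or> i + S \<le> y)"
          using False that xy left i pos by (auto simp: vunshift_def)
        then show ?thesis unfolding graft using False l' sz i left pos
          by (auto simp: lab_Node sizes')
      qed
    next
      case right
      then have "vunshift S i x = x + 1 - S" "vunshift S i y = y + 1 - S"
        using xy pos i by (auto simp: vunshift_def)
      then show ?thesis unfolding graft using right xy pos i sz
        by (auto simp: lab_Node_right sizes' add.commute[of S N])
    next
      case cross
      then have "lab (Node l' g r) x y = one"
        using xy pos i sz by (intro lab_Node_cross) (auto simp: sizes')
      moreover have "lab (Node l g r) (vunshift S i x) (vunshift S i y) = one"
        if "y \<le> i \<or> i + S \<le> y" "x \<le> i \<or> i + S \<le> x"
        using that cross xy pos i by (intro lab_Node_cross) (auto simp: sizes' vunshift_def)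
      moreover have "\<not> (i \<le> x \<and> y \<le> i + S)" using cross xy pos i by auto
      ultimately show ?thesis unfolding graft using pos by (auto simp: sizes')
    qed
  next
    case False
    define r' where "r' = graft r (i - N) s"
    have i: "N < i" using False by simp
    have sz: "size1 r' = R + S - 1"
      using size1_graft[of "i - N" r s] i xy by (simp add: sizes r'_def)
    have graft: "graft (Node l g r) i s = Node l g r'" using i by (simp add: sizes r'_def)
    consider (base) "x = 1" "y = N + R + S" | (left) "y \<le> N + 1" | (right) "N + 1 \<le> x"
      | (cross) "x < N + 1" "N + 1 < y" "\<not> (x = 1 \<and> y = N + R + S)" by linarith
    then show ?thesis
    proof cases
      case base
      then show ?thesis unfolding graft using xy pos i sz by (simp add: lab_Node vunshift_def sizes')
    next
      case left
      then show ?thesis unfolding graft using xy pos i sz by (auto simp: lab_Node_left sizes' vunshift_def)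
    next
      case right
      have r': "lab r' (x - N) (y - N) = (if x = i \<and> y = i + S then star (lab r (i - N) (i - N + 1)) (base s)
         else if (x \<le> i \<or> i + S \<le> x) \<and> (y \<le> i \<or> i + S \<le> y)
           then lab r (vunshift S i x - N) (vunshift S i y - N)
         else if i \<le> x \<and> y \<le> i + S then lab s (x + 1 - i) (y + 1 - i) else one)"
      proof -
        \<comment> \<open>Inside the right subtree the vertices and the leaf number are all shifted
          by \<open>N\<close>. Truncated subtraction does no harm here, since \<open>N < i\<close>
          and \<open>N + 1 \<le> x\<close>.\<close>
        have eqs: "x - N = i - N \<longleftrightarrow> x = i" "y - N = i - N + S \<longleftrightarrow> y = i + S"
          "x - N \<le> i - N \<longleftrightarrow> x \<le> i" "i - N + S \<le> x - N \<longleftrightarrow> i + S \<le> x"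
          "y - N \<le> i - N \<longleftrightarrow> y \<le> i" "i - N + S \<le> y - N \<longleftrightarrow> i + S \<le> y"
          "i - N \<le> x - N \<longleftrightarrow> i \<le> x" "y - N \<le> i - N + S \<longleftrightarrow> y \<le> i + S"
          "x - N + 1 - (i - N) = x + 1 - i" "y - N + 1 - (i - N) = y + 1 - i"
          "vunshift S (i - N) (x - N) = vunshift S i x - N" "vunshift S (i - N) (y - N) = vunshift S i y - N"
          using i right xy pos by (auto simp: vunshift_def)
        show ?thesis unfolding r'_def using IH(2)[of "i - N" "x - N" "y - N"] xy right i
          unfolding eqs by (simp add: sizes')
      qed
      show ?thesis
      proof (cases "x = N + 1 \<and> y = N + R + S")
        case True
        then have b: "base r' = lab r' (x - N) (y - N)" using sz pos by simp
        show ?thesis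
        proof (cases "i = N + 1 \<and> R = 1")
          case t: True
          then have "r = Leaf" using size1_1_iff[of r] by (simp add: sizes)
          then show ?thesis unfolding graft using True t r' b sz pos
            by (simp add: lab_Node sizes' left_unit right_unit)
        next
          case False
          then show ?thesis unfolding graft using True r' b sz xy i pos
            by (auto simp: lab_Node_right sizes' vunshift_def)
        qed
      next
        case False
        have "vunshift S i x \<noteq> N + 1 \<or> vunshift S i y \<noteq> N + R + 1"
           "N + 1 \<le> vunshift S i x"  "\<not> (x = i \<and> y = i + S \<and> i = N + 1 \<and> R = 1)"
           "x = i \<and> y = i + S \<or> vunshift S i x < vunshift S i y"
          if "(x \<le> i \<or> i + S \<le> x) \<and> (y \<le> i \<or> i + S \<le> y)"
          using False that xy right i pos by (auto simp: vunshift_def)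
        then have "lab (Node l g r) (vunshift S i x) (vunshift S i y) =
            lab r (vunshift S i x - N) (vunshift S i y - N)"
          if "(x \<le> i \<or> i + S \<le> x) \<and> (y \<le> i \<or> i + S \<le> y)" "\<not> (x = i \<and> y = i + S)"
          using that by (subst lab_Node_right) (auto simp: sizes')
        moreover have "lab (Node l g r) i (i + 1) = lab r (i - N) (i - N + 1)" if "x = i" "y = i + S"
          using False that i xy by (subst lab_Node_right) (auto simp: sizes' Suc_diff_le)
        moreover have "lab (Node l g r') x y = lab r' (x - N) (y - N)"
          using False right xy sz pos by (subst lab_Node_right) (auto simp: sizes')
        ultimately show ?thesis unfolding graft sizes' r' by simp
      qed
    next
      case cross
      then have "lab (Node l g r') x y = one"
        using xy pos i sz by (intro lab_Node_cross) (auto simp: sizes')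
      moreover have "lab (Node l g r) (vunshift S i x) (vunshift S i y) = one"
        if "y \<le> i \<or> i + S \<le> y" "x \<le> i \<or> i + S \<le> x"
        using that cross xy pos i by (intro lab_Node_cross) (auto simp: sizes' vunshift_def)
      moreover have "\<not> (i \<le> x \<and> y \<le> i + S)" using cross xy pos i by auto
      ultimately show ?thesis unfolding graft using pos by (auto simp: sizes')
    qed
  qed
qed

text \<open>Two crossing arcs either lie on one side of the apex, where induction applies and
  neither is the base of the subtree, or one of them passes over the apex. The latter arc is not the
  base, which crosses nothing, so its label is \<open>one\<close>.\<close>

lemma lab_noncrossing:
  assumes "1 \<le> x" "x < x'" "x' < y" "y < y'" "y' \<le> size1 t + 1"
  shows "lab t x y = one \<or> lab t x' y' = one"
  using assms
proof (induction t arbitrary: x y x' y')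
  case (Node l g r)
  consider (left) "y' \<le> size1 l + 1" | (right) "size1 l + 1 \<le> x"
    | (first) "x < size1 l + 1" "size1 l + 1 < y" | (second) "x' < size1 l + 1" "size1 l + 1 < y'"
    using Node.prems by linarith
  then show ?case
  proof cases
    case left
    then show ?thesis using Node.prems Node.IH(1)[of x x' y y'] by (auto simp: lab_Node_left)
  next
    case right
    have "lab r (x - size1 l) (y - size1 l) = one \<or> lab r (x' - size1 l) (y' - size1 l) = one"
      by (rule Node.IH(2)) (use right Node.prems in auto)
    then show ?thesis using right Node.prems by (auto simp: lab_Node_right)
  qed (use Node.prems in \<open>auto simp: lab_Node_cross\<close>)
qed simp

text \<open>With a common apex the two sides of the polygon are independent. The base labels of the
  subtrees enter only through products with the edges of the root, and these products are what
  relations (1) and (3) preserve.\<close>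

lemma same_labels_Node_iff:
  assumes "size1 l = size1 l'" "size1 r = size1 r'"
  shows "same_labels (size1 (Node l g r)) (lab (Node l g r)) (lab (Node l' g' r')) \<longleftrightarrow>
    g (1, 3) = g' (1, 3) \<and> star (g (1, 2)) (base l) = star (g' (1, 2)) (base l')
    \<and> star (g (2, 3)) (base r) = star (g' (2, 3)) (base r')
    \<and> same_inner_labels (size1 l) (lab l) (lab l') \<and> same_inner_labels (size1 r) (lab r) (lab r')"
    (is "?L \<longleftrightarrow> ?R")
proof
  note [simp] = assms
  assume ?L
  note pt = same_labelsD[OF this]
  have "same_inner_labels (size1 l) (lab l) (lab l')" unfolding same_inner_labels_def
  proof (intro allI impI)
    fix x y assume "1 \<le> x" "x < y" "y \<le> size1 l + 1" "(x, y) \<noteq> (1, size1 l + 1)"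
    then show "lab l x y = lab l' x y" using pt[of x y] by (auto simp: lab_Node_left)
  qed
  moreover have "same_inner_labels (size1 r) (lab r) (lab r')" unfolding same_inner_labels_def
  proof (intro allI impI)
    fix x y assume "1 \<le> x" "x < y" "y \<le> size1 r + 1" "(x, y) \<noteq> (1, size1 r + 1)"
    then show "lab r x y = lab r' x y" using pt[of "x + size1 l" "y + size1 l"]
      by (auto simp: lab_Node_right)
  qed
  ultimately show ?R
    using pt[of 1 "size1 l + size1 r + 1"] pt[of 1 "size1 l + 1"]
      pt[of "size1 l + 1" "size1 l + size1 r + 1"] by (simp add: lab_Node)
next
  note [simp] = assms
  assume R: ?R
  show ?L unfolding same_labels_def
  proof (intro allI impI)
    fix x y assume xy: "1 \<le> x" "x < y" "y \<le> size1 (Node l g r) + 1"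
    consider (base) "x = 1" "y = size1 l + size1 r + 1" | (left) "y \<le> size1 l + 1" | (right) "size1 l + 1 \<le> x"
      | (cross) "x < size1 l + 1" "size1 l + 1 < y" "(x, y) \<noteq> (1, size1 l + size1 r + 1)" by force
    then show "lab (Node l g r) x y = lab (Node l' g' r') x y"
    proof cases
      case base
      then show ?thesis using R by (simp add: lab_Node_base)
    next
      case left
      then show ?thesis using R xy by (auto simp: lab_Node_left same_inner_labels_def)
    next
      case right
      have "lab r (x - size1 l) (y - size1 l) = lab r' (x - size1 l) (y - size1 l)"
        if "\<not> (x = size1 l + 1 \<and> y = size1 l + size1 r + 1)"
        using R that right xy by (intro same_inner_labelsD[of "size1 r" "lab r" "lab r'"]) auto
      then show ?thesis using R xy right by (auto simp: lab_Node_right)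
    next
      case cross
      then show ?thesis by (simp add: lab_Node_cross)
    qed
  qed
qed

text \<open>Only the base arc sees the base label of the root. Relations (1) and (3) change the
  inner triangle in no other way.\<close>

lemma same_inner_labels_retriangle:
  "same_inner_labels (size1 l + size1 r) (lab (Node l (triangle a b c) r)) (lab (Node l (triangle a' b c) r))"
  by (auto simp: same_inner_labels_def lab.simps(2))

section \<open>Noncrossing labellings and triangulations realising them\<close>

definition noncrossing :: "nat \<Rightarrow> (nat \<Rightarrow> nat \<Rightarrow> 'm) \<Rightarrow> bool" where
  "noncrossing n p \<longleftrightarrow> (\<forall>x x' y y'. 1 \<le> x \<longrightarrow> x < x' \<longrightarrow> x' < y \<longrightarrow> y < y' \<longrightarrow> y' \<le> n + 1 \<longrightarrow>
     p x y = one \<or> p x' y' = one)"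

text \<open>This is the condition for \<open>k\<close> to be usable as apex of the root triangle,
  since \<open>lab\<close> puts \<open>one\<close> on every arc over the apex except the
  base.\<close>

definition splits_at :: "nat \<Rightarrow> (nat \<Rightarrow> nat \<Rightarrow> 'm) \<Rightarrow> nat \<Rightarrow> bool" where
  "splits_at n p k \<longleftrightarrow> 1 < k \<and> k < n + 1 \<and>
     (\<forall>x y. 1 \<le> x \<longrightarrow> x < k \<longrightarrow> k < y \<longrightarrow> y \<le> n + 1 \<longrightarrow> (x, y) \<noteq> (1, n + 1) \<longrightarrow> p x y = one)"

text \<open>Take the last vertex \<open>k \<le> n\<close> joined to vertex 1 by a solid diagonal. An
  arc from 1 over \<open>k\<close> is trivial by maximality, and an arc from a later vertex over
  \<open>k\<close> crosses the solid diagonal \<open>(1, k)\<close>.\<close>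

lemma noncrossing_splits:
  assumes "noncrossing n p" "2 \<le> n"
  obtains k where "splits_at n p k"
proof -
  \<comment> \<open>The default 2 covers the absence of solid diagonals at vertex 1; then no vertex
    lies strictly between 1 and \<open>k\<close>.\<close>
  define S where "S = insert 2 {k. 2 < k \<and> k \<le> n \<and> p 1 k \<noteq> one}"
  define k where "k = Max S"
  have fin: "finite S" unfolding S_def by auto
  have kS: "k \<in> S" unfolding k_def using fin by (intro Max_in) (auto simp: S_def)
  have mx: "j \<le> k" if "j \<in> S" for j unfolding k_def using fin that by (rule Max_ge)
  have "p x y = one" if "1 \<le> x" "x < k" "k < y" "y \<le> n + 1" "(x, y) \<noteq> (1, n + 1)" for x y
  proof (cases "x = 1")
    case True
    then have "y \<notin> S" using mx[of y] that by auto
    then show ?thesis using True that kS by (auto simp: S_def)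
  next
    case False
    then have "p 1 k \<noteq> one" using kS that by (auto simp: S_def)
    then show ?thesis using assms(1) False that unfolding noncrossing_def
      by (metis One_nat_def le_neq_implies_less order_refl)
  qed
  then have "splits_at n p k" using kS assms(2) by (auto simp: splits_at_def S_def)
  then show ?thesis by (rule that)
qed

text \<open>The polygon is cut at the prescribed apex and both pieces are realised by smaller trees.
  Existence in smaller arities is a hypothesis, so that the lemma serves first inside the induction
  for \<open>exists_tree\<close> and then, with that result, for
  \<open>exists_tree_split\<close>.\<close>

lemma exists_tree_split_aux:
  assumes IH: "\<And>m q. m < n \<Longrightarrow> 1 \<le> m \<Longrightarrow> noncrossing m q \<Longrightarrow> (m = 1 \<Longrightarrow> q 1 2 = one) \<Longrightarrow>
      \<exists>t\<in>syntax_trees (triangles one) m. same_labels m (lab t) q"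
    and nc: "noncrossing n p" and split: "splits_at n p (j + 1)"
  shows "\<exists>l r b c. Node l (triangle (p 1 (n + 1)) b c) r \<in> syntax_trees (triangles one) n \<and> size1 l = j
    \<and> same_labels n (lab (Node l (triangle (p 1 (n + 1)) b c) r)) p"
proof -
  have j: "1 \<le> j" "j < n" using split by (auto simp: splits_at_def)
  \<comment> \<open>The labels of the two cutting arcs go to the edges of the root triangle, and the
    pieces get base \<open>one\<close>. The products then return the original labels, and a piece of
    arity 1 satisfies the unit convention.\<close>
  define q where "q = (\<lambda>x y. if x = 1 \<and> y = j + 1 then one else p x y)"
  define q' where "q' = (\<lambda>x y. if x = 1 \<and> y = n - j + 1 then one else p (x + j) (y + j))"
  have "noncrossing j q" using nc j unfolding noncrossing_def q_def
    by (smt (verit, best) add_le_mono1 less_imp_le_nat order_trans)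
  then obtain l where l: "l \<in> syntax_trees (triangles one) j" "same_labels j (lab l) q"
    using IH[of j q] j by (auto simp: q_def)
  have "noncrossing (n - j) q'" unfolding noncrossing_def
  proof (intro allI impI)
    fix x x' y y' assume "1 \<le> x" "x < x'" "x' < y" "y < y'" "y' \<le> n - j + 1"
    then have "p (x + j) (y + j) = one \<or> p (x' + j) (y' + j) = one"
      using nc j unfolding noncrossing_def by auto
    then show "q' x y = one \<or> q' x' y' = one" by (auto simp: q'_def)
  qed
  then obtain r where r: "r \<in> syntax_trees (triangles one) (n - j)" "same_labels (n - j) (lab r) q'"
    using IH[of "n - j" q'] j by (fastforce simp: q'_def)
  have sz: "size1 l = j" "size1 r = n - j" using l r by (auto simp: syntax_trees_def)
  let ?t = "Node l (triangle (p 1 (n + 1)) (p 1 (j + 1)) (p (j + 1) (n + 1))) r"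
  have "same_labels n (lab ?t) p" unfolding same_labels_def
  proof (intro allI impI)
    fix x y assume xy: "1 \<le> x" "x < y" "y \<le> n + 1"
    show "lab ?t x y = p x y"
    proof (cases "y \<le> j + 1 \<or> j + 1 \<le> x")
      case True
      then show ?thesis using xy j sz same_labelsD[OF l(2), of x y]
         same_labelsD[OF r(2), of "x - j" "y - j"] same_labelsD[OF r(2), of 1 "n - j + 1"]
        by (auto simp: q_def q'_def right_unit lab_Node)
    next
      case False
      then show ?thesis using xy j sz split
        by (cases "x = 1 \<and> y = n + 1") (auto simp: splits_at_def lab_Node)
    qed
  qed
  moreover have "?t \<in> syntax_trees (triangles one) n"
    using l r j by (auto simp: syntax_trees_def)
  ultimately show ?thesis using sz(1)
    by (intro exI[of _ l] exI[of _ r] exI[of _ "p 1 (j + 1)"] exI[of _ "p (j + 1) (n + 1)"]) simp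
qed

lemma exists_tree:
  assumes "1 \<le> n" "noncrossing n p" "n = 1 \<Longrightarrow> p 1 2 = one"
  shows "\<exists>t\<in>syntax_trees (triangles one) n. same_labels n (lab t) p"
  using assms
proof (induction n arbitrary: p rule: less_induct)
  case (less n)
  show ?case
  proof (cases "n = 1")
    case True
    have "same_labels n (lab Leaf) p" unfolding same_labels_def
    proof (intro allI impI)
      fix x y assume "1 \<le> x" "x < y" "y \<le> n + 1"
      then have "x = 1" "y = 2" using True by auto
      then show "lab Leaf x y = p x y" using less.prems(3) True by simp
    qed
    then show ?thesis using True by (intro bexI[of _ Leaf]) (auto simp: syntax_trees_def simp del: lab.simps)
  next
    case False
    then obtain k where "splits_at n p k"
      using less.prems noncrossing_splits[of n p] by auto
    then have "splits_at n p ((k - 1) + 1)" by (simp add: splits_at_def)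
    then have "\<exists>l r b c. Node l (triangle (p 1 (n + 1)) b c) r \<in> syntax_trees (triangles one) n
        \<and> size1 l = k - 1 \<and> same_labels n (lab (Node l (triangle (p 1 (n + 1)) b c) r)) p"
      by (intro exists_tree_split_aux less.IH less.prems(2))
    then show ?thesis by (elim exE conjE) (rule bexI)
  qed
qed

text \<open>The apex of the root can be prescribed among all admissible vertices; the flip below
  relies on this freedom.\<close>

lemma exists_tree_split:
  assumes "noncrossing n p" "splits_at n p (j + 1)"
  obtains l r b c where "Node l (triangle (p 1 (n + 1)) b c) r \<in> syntax_trees (triangles one) n"
    "size1 l = j" "same_labels n (lab (Node l (triangle (p 1 (n + 1)) b c) r)) p"
proof -
  have "\<exists>l r b c. Node l (triangle (p 1 (n + 1)) b c) r \<in> syntax_trees (triangles one) n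
      \<and> size1 l = j \<and> same_labels n (lab (Node l (triangle (p 1 (n + 1)) b c) r)) p"
    by (intro exists_tree_split_aux exists_tree assms)
  then show ?thesis by (elim exE conjE) (rule that)
qed

section \<open>Equivalence of syntax trees\<close>

text \<open>The congruence generated by the three relations, with their side conditions kept as they
  are. Arbitrary subtrees \<open>A\<close>, \<open>B\<close>, \<open>C\<close> account for grafting
  onto the leaves of a relator, the two congruence rules for grafting a relator into a larger
  tree.\<close>

inductive tree_equiv :: "'m clique tree \<Rightarrow> 'm clique tree \<Rightarrow> bool" (infix "\<approx>" 50) where
  refl: "t \<approx> t"
| sym: "t \<approx> s \<Longrightarrow> s \<approx> t"
| trans: "t \<approx> s \<Longrightarrow> s \<approx> u \<Longrightarrow> t \<approx> u"
| cong_left: "l \<approx> l' \<Longrightarrow> Node l g r \<approx> Node l' g r"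
| cong_right: "r \<approx> r' \<Longrightarrow> Node l g r \<approx> Node l g r'"
| left_left: "star p1 q0 = star r1 r0 \<Longrightarrow> star r1 r0 \<noteq> one \<Longrightarrow>
    Node (Node A (triangle q0 q1 q2) B) (triangle p0 p1 p2) C \<approx>
    Node (Node A (triangle r0 q1 q2) B) (triangle p0 r1 p2) C"
| left_right: "star p1 q0 = star r2 r0 \<Longrightarrow> star r2 r0 = one \<Longrightarrow>
    Node (Node A (triangle q0 q1 q2) B) (triangle p0 p1 p2) C \<approx>
    Node A (triangle p0 q1 r2) (Node B (triangle r0 q2 p2) C)"
| right_right: "star p2 q0 = star r2 r0 \<Longrightarrow> star r2 r0 \<noteq> one \<Longrightarrow>
    Node A (triangle p0 p1 p2) (Node B (triangle q0 q1 q2) C) \<approx>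
    Node A (triangle p0 p1 r2) (Node B (triangle r0 q1 q2) C)"

declare tree_equiv.trans [trans]

section \<open>Soundness: equivalent trees draw the same labels\<close>

lemma tree_equiv_size1: "t \<approx> s \<Longrightarrow> size1 t = size1 s"
  by (induction rule: tree_equiv.induct) simp_all

lemma tree_equiv_triangles: "t \<approx> s \<Longrightarrow> set_tree t \<subseteq> triangles one \<longleftrightarrow> set_tree s \<subseteq> triangles one"
  by (induction rule: tree_equiv.induct) auto

lemma tree_equiv_lab: "t \<approx> s \<Longrightarrow> same_labels (size1 t) (lab t) (lab s)"
proof (induction rule: tree_equiv.induct)
  case (sym t s)
  then show ?case by (simp add: tree_equiv_size1 same_labels_sym)
next
  case (trans t s u)
  then show ?case by (metis tree_equiv_size1 same_labels_trans)
next
  case (cong_left l l' g r)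
  then show ?case using tree_equiv_size1[OF cong_left(1)]
    by (subst same_labels_Node_iff) (simp_all add: same_labels_iff_inner)
next
  case (cong_right r r' l g)
  then show ?case using tree_equiv_size1[OF cong_right(1)]
    by (subst same_labels_Node_iff) (simp_all add: same_labels_iff_inner)
next
  case (left_left p1 q0 r1 r0 A q1 q2 B p0 p2 C)
  then show ?case
    using same_inner_labels_retriangle
    by (subst same_labels_Node_iff) (simp_all add: lab_Node_base)
next
  case (right_right p2 q0 r2 r0 A p0 p1 B q1 q2 C)
  then show ?case
    using same_inner_labels_retriangle
    by (subst same_labels_Node_iff) (simp_all add: lab_Node_base)
next
  case (left_right p1 q0 r2 r0 A q1 q2 B p0 p2 C)
  define \<alpha> \<beta> \<gamma> where sizes: "\<alpha> = size1 A" "\<beta> = size1 B" "\<gamma> = size1 C"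
  note sizes' = sizes [symmetric]
  have pos: "1 \<le> \<alpha>" "1 \<le> \<beta>" "1 \<le> \<gamma>" by (simp_all add: sizes)
  let ?AB = "Node A (triangle q0 q1 q2) B" and ?BC = "Node B (triangle r0 q2 p2) C"
  show ?case unfolding same_labels_def
  proof (intro allI impI)
    fix x y assume "1 \<le> x" "x < y" "y \<le> size1 (Node ?AB (triangle p0 p1 p2) C) + 1"
    then have xy: "1 \<le> x" "x < y" "y \<le> \<alpha> + \<beta> + \<gamma> + 1" by (simp_all add: sizes)
    \<comment> \<open>The two trees differ in one diagonal. The one closing \<open>A\<close> and
      \<open>B\<close> carries \<open>star p1 q0 = one\<close> on the left and passes over the apex
      of the root on the right; the one closing \<open>B\<close> and \<open>C\<close> passes over
      the apex on the left and carries \<open>star r2 r0 = one\<close> on the right. All four labels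
      are \<open>one\<close>.\<close>
    consider (base) "x = 1" "y = \<alpha> + \<beta> + \<gamma> + 1" | (A) "y \<le> \<alpha> + 1"
      | (B) "\<alpha> + 1 \<le> x" "y \<le> \<alpha> + \<beta> + 1" | (C) "\<alpha> + \<beta> + 1 \<le> x"
      | (AB) "x < \<alpha> + 1" "\<alpha> + 1 < y" "y \<le> \<alpha> + \<beta> + 1"
      | (BC) "\<alpha> + 1 \<le> x" "x < \<alpha> + \<beta> + 1" "\<alpha> + \<beta> + 1 < y"
      | (ABC) "x < \<alpha> + 1" "\<alpha> + \<beta> + 1 < y" "\<not> (x = 1 \<and> y = \<alpha> + \<beta> + \<gamma> + 1)" by linarith
    then show "lab (Node ?AB (triangle p0 p1 p2) C) x y = lab (Node A (triangle p0 q1 r2) ?BC) x y"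
    proof cases
      case ABC
      then show ?thesis using xy pos by (simp add: lab_Node_cross sizes' add.assoc)
    next
      case BC
      then have "\<not> (x = \<alpha> + 1 \<and> y = \<alpha> + \<beta> + \<gamma> + 1) \<Longrightarrow> lab ?BC (x - \<alpha>) (y - \<alpha>) = one"
        by (intro lab_Node_cross) (auto simp: sizes')
      then show ?thesis using BC xy pos left_right
        by (cases "x = \<alpha> + 1 \<and> y = \<alpha> + \<beta> + \<gamma> + 1") (simp_all add: lab_Node sizes' add.assoc)
    next
      case AB
      then show ?thesis using xy pos left_right
        by (cases "x = 1 \<and> y = \<alpha> + \<beta> + 1") (simp_all add: lab_Node sizes')
    qed (use xy pos in \<open>auto simp: lab_Node sizes'\<close>)
  qed
qed simp_all

text \<open>When the product is \<open>one\<close>, relation (2) is applied forth and back, through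
  the flipped tree whose diagonal is factored as \<open>star one one\<close>.\<close>

lemma left_left':
  assumes "star p1 q0 = star r1 r0"
  shows "Node (Node A (triangle q0 q1 q2) B) (triangle p0 p1 p2) C \<approx>
    Node (Node A (triangle r0 q1 q2) B) (triangle p0 r1 p2) C"
proof (cases "star r1 r0 = one")
  case True
  show ?thesis
    by (rule tree_equiv.trans[OF left_right[of _ _ one one] tree_equiv.sym[OF left_right]])
      (simp_all add: True assms left_unit)
qed (simp add: assms left_left)

text \<open>The same detour with relation (2) taken first backwards, then forwards.\<close>

lemma right_right':
  assumes "star p2 q0 = star r2 r0"
  shows "Node A (triangle p0 p1 p2) (Node B (triangle q0 q1 q2) C) \<approx>
    Node A (triangle p0 p1 r2) (Node B (triangle r0 q1 q2) C)"
proof (cases "star r2 r0 = one")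
  case True
  show ?thesis
    by (rule tree_equiv.trans[OF tree_equiv.sym[OF left_right[of one one]] left_right])
      (simp_all add: True assms left_unit)
qed (simp add: assms right_right)

section \<open>Completeness: trees with equal labels are equivalent\<close>

fun rebase :: "'m \<Rightarrow> 'm clique tree \<Rightarrow> 'm clique tree" where
  "rebase a Leaf = Leaf"
| "rebase a (Node l g r) = Node l (triangle a (g (1, 2)) (g (2, 3))) r"

lemma size1_rebase [simp]: "size1 (rebase a t) = size1 t"
  by (cases t) simp_all

lemma rebase_triangles: "set_tree t \<subseteq> triangles one \<Longrightarrow> set_tree (rebase a t) \<subseteq> triangles one"
  by (cases t) auto

text \<open>This replaces one factorisation of the diagonal label by another, using
  \<open>left_left'\<close>. A leaf has no base label to change; then \<open>l'\<close> is a leaf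
  too, and the products reduce to \<open>b = b'\<close>.\<close>

lemma rebase_left:
  assumes "set_tree l \<subseteq> triangles one" "size1 l = size1 l'" "star b (base l) = star b' (base l')"
  shows "Node l (triangle a b c) r \<approx> Node (rebase (base l') l) (triangle a b' c) r"
proof (cases l)
  case Leaf
  then show ?thesis using assms size1_1_iff[of l'] by (simp add: right_unit tree_equiv.refl)
next
  case (Node l1 g l2)
  obtain q0 q1 q2 where g: "g = triangle q0 q1 q2" using assms(1) Node by (auto elim: triangle_cases)
  show ?thesis using assms(3) by (auto simp: Node g lab_Node intro!: left_left')
qed

lemma rebase_right:
  assumes "set_tree r \<subseteq> triangles one" "size1 r = size1 r'" "star c (base r) = star c' (base r')"
  shows "Node l (triangle a b c) r \<approx> Node l (triangle a b c') (rebase (base r') r)"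
proof (cases r)
  case Leaf
  then show ?thesis using assms size1_1_iff[of r'] by (simp add: right_unit tree_equiv.refl)
next
  case (Node l1 g l2)
  obtain q0 q1 q2 where g: "g = triangle q0 q1 q2" using assms(1) Node by (auto elim: triangle_cases)
  show ?thesis using assms(3) by (auto simp: Node g lab_Node intro!: right_right')
qed

lemma lab_rebase:
  assumes "set_tree t \<subseteq> triangles one" "size1 t = size1 t'" "same_inner_labels (size1 t) (lab t) (lab t')"
  shows "same_labels (size1 t) (lab (rebase (base t') t)) (lab t')"
proof (cases t)
  case Leaf
  then show ?thesis using assms size1_1_iff[of t'] by simp
next
  case (Node l g r)
  obtain a b c where g: "g = triangle a b c" using assms(1) Node by (auto elim: triangle_cases)
  have "same_inner_labels (size1 t) (lab (rebase (base t') t)) (lab t)"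
    using same_inner_labels_retriangle by (simp add: Node g)
  then have "same_inner_labels (size1 t) (lab (rebase (base t') t)) (lab t')"
    using assms(3) by (simp add: same_inner_labels_def)
  moreover have "lab (rebase (base t') t) 1 (size1 t + 1) = base t'"
    by (simp add: Node lab_Node_base)
  ultimately show ?thesis using assms(2) by (simp add: same_labels_iff_inner)
qed

text \<open>The factors at both sides of the root are matched by rebasing, and the subtrees are then
  compared by induction. The induction hypothesis is an assumption, since the flip argument also
  ends with this step.\<close>

lemma tree_equiv_same_split:
  assumes IH: "\<And>u v. size1 u < size1 (Node l g r) \<Longrightarrow> set_tree u \<subseteq> triangles one \<Longrightarrow>
      set_tree v \<subseteq> triangles one \<Longrightarrow> size1 u = size1 v \<Longrightarrow> same_labels (size1 u) (lab u) (lab v) \<Longrightarrow> u \<approx> v"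
    and t: "set_tree (Node l g r) \<subseteq> triangles one" and t': "set_tree (Node l' g' r') \<subseteq> triangles one"
    and sz: "size1 l = size1 l'" "size1 r = size1 r'"
    and same: "same_labels (size1 (Node l g r)) (lab (Node l g r)) (lab (Node l' g' r'))"
  shows "Node l g r \<approx> Node l' g' r'"
proof -
  obtain a b c where g: "g = triangle a b c" using t by (auto elim: triangle_cases)
  obtain a' b' c' where g': "g' = triangle a' b' c'" using t' by (auto elim: triangle_cases)
  from same have same': "a = a'" "star b (base l) = star b' (base l')" "star c (base r) = star c' (base r')"
    "same_inner_labels (size1 l) (lab l) (lab l')" "same_inner_labels (size1 r) (lab r) (lab r')"
    using same_labels_Node_iff[OF sz] by (simp_all add: g g')
  have "same_labels (size1 l) (lab (rebase (base l') l)) (lab l')"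
    using t sz same' by (intro lab_rebase) auto
  \<comment> \<open>Rebasing has made the base labels agree as well, so the hypothesis for smaller
    trees applies.\<close>
  then have l: "rebase (base l') l \<approx> l'" using t t' sz
    by (intro IH) (auto intro!: rebase_triangles)
  have "same_labels (size1 r) (lab (rebase (base r') r)) (lab r')"
    using t sz same' by (intro lab_rebase) auto
  then have r: "rebase (base r') r \<approx> r'" using t t' sz
    by (intro IH) (auto intro!: rebase_triangles)
  have "Node l g r \<approx> Node (rebase (base l') l) (triangle a b' c) r"
    unfolding g by (rule rebase_left) (use t sz same' in auto)
  also have "\<dots> \<approx> Node l' (triangle a b' c) r"
    using l by (rule cong_left)
  also have "\<dots> \<approx> Node l' (triangle a b' c') (rebase (base r') r)"
    by (rule rebase_right) (use t sz same' in auto)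
  also have "\<dots> \<approx> Node l' (triangle a b' c') r'"
    using r by (rule cong_right)
  finally show ?thesis by (simp add: g' same')
qed

lemma tree_equiv_flip:
  assumes IH: "\<And>u v. size1 u < size1 (Node l g r) \<Longrightarrow> set_tree u \<subseteq> triangles one \<Longrightarrow>
      set_tree v \<subseteq> triangles one \<Longrightarrow> size1 u = size1 v \<Longrightarrow> same_labels (size1 u) (lab u) (lab v) \<Longrightarrow> u \<approx> v"
    and t: "set_tree (Node l g r) \<subseteq> triangles one" and t': "set_tree (Node l' g' r') \<subseteq> triangles one"
    and sz: "size1 l < size1 l'" "size1 l + size1 r = size1 l' + size1 r'"
    and same: "same_labels (size1 (Node l g r)) (lab (Node l g r)) (lab (Node l' g' r'))"
  shows "Node l g r \<approx> Node l' g' r'"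
proof -
  obtain a b c where g: "g = triangle a b c" using t by (auto elim: triangle_cases)
  note pt = same_labelsD[OF same]
  have pos: "size1 l \<ge> 1" "size1 l' - size1 l < size1 r" using sz size1_ge0[of r'] by (simp, linarith)
  \<comment> \<open>In the second tree the arc from the apex \<open>size1 l + 1\<close> to the last
    vertex passes over the apex \<open>size1 l' + 1\<close>, hence it is trivial there, and so also
    in the first tree.\<close>
  have c: "star c (base r) = one"
    using pt[of "size1 l + 1" "size1 l + size1 r + 1"] sz pos by (simp add: g lab_Node)
  \<comment> \<open>Likewise every arc of \<open>r\<close> over the apex of the second tree is
    trivial, its own base excepted, so \<open>r\<close> may be retriangulated with that vertex as
    apex.\<close>
  have "lab r x y = one" if "1 \<le> x" "x < size1 l' - size1 l + 1" "size1 l' - size1 l + 1 < y"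
    "y \<le> size1 r + 1" "(x, y) \<noteq> (1, size1 r + 1)" for x y
    using that sz pos pt[of "x + size1 l" "y + size1 l"] by (auto simp: lab_Node)
  then have "splits_at (size1 r) (lab r) ((size1 l' - size1 l) + 1)"
    using sz pos by (auto simp: splits_at_def)
  moreover have "noncrossing (size1 r) (lab r)" unfolding noncrossing_def
    using lab_noncrossing by blast
  ultimately obtain u v d e where
    uv: "Node u (triangle (base r) d e) v \<in> syntax_trees (triangles one) (size1 r)"
      "size1 u = size1 l' - size1 l" "same_labels (size1 r) (lab (Node u (triangle (base r) d e) v)) (lab r)"
    by (elim exists_tree_split)
  have "r \<approx> Node u (triangle (base r) d e) v" using uv t
    by (intro IH) (auto simp: syntax_trees_def intro: same_labels_sym)
  then have "Node l g r \<approx> Node l g (Node u (triangle (base r) d e) v)" by (rule cong_right)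
  \<comment> \<open>Relation (2) backwards: the old diagonal has product \<open>one\<close> by
    \<open>c\<close>, and the new one is factored as \<open>star one one\<close>. The root now has
    the same apex as the second tree.\<close>
  also have "\<dots> \<approx> Node (Node l (triangle one b d) u) (triangle a one e) v"
    unfolding g by (rule tree_equiv.sym, rule left_right) (simp_all add: c[simplified] left_unit)
  finally have flip: "Node l g r \<approx> Node (Node l (triangle one b d) u) (triangle a one e) v" .
  also have "\<dots> \<approx> Node l' g' r'"
  proof (rule tree_equiv_same_split)
    show "same_labels (size1 (Node (Node l (triangle one b d) u) (triangle a one e) v))
      (lab (Node (Node l (triangle one b d) u) (triangle a one e) v)) (lab (Node l' g' r'))"
      using same_labels_trans[OF same_labels_sym[OF tree_equiv_lab[OF flip]] same]
      unfolding tree_equiv_size1[OF flip] .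
    show "set_tree (Node (Node l (triangle one b d) u) (triangle a one e) v) \<subseteq> triangles one"
      using tree_equiv_triangles[OF flip] t by blast
    have "size1 (Node (Node l (triangle one b d) u) (triangle a one e) v) = size1 (Node l g r)"
      using tree_equiv_size1[OF flip] by simp
    then show "x \<approx> y" if "size1 x < size1 (Node (Node l (triangle one b d) u) (triangle a one e) v)"
      "set_tree x \<subseteq> triangles one" "set_tree y \<subseteq> triangles one" "size1 x = size1 y"
      "same_labels (size1 x) (lab x) (lab y)" for x y using that by (intro IH) auto
  qed (use uv sz t' in \<open>auto simp: syntax_trees_def\<close>)
  finally show ?thesis .
qed

text \<open>Strong induction on the arity. The apexes of the roots coincide or one precedes the
  other, and symmetry reduces the last case to the flip.\<close>

lemma tree_equiv_complete:
  assumes "set_tree t \<subseteq> triangles one" "set_tree t' \<subseteq> triangles one" "size1 t = size1 t'"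
    "same_labels (size1 t) (lab t) (lab t')"
  shows "t \<approx> t'"
  using assms
proof (induction "size1 t" arbitrary: t t' rule: less_induct)
  case less
  show ?case
  proof (cases t)
    case Leaf
    then show ?thesis using less.prems size1_1_iff[of t'] by (simp add: tree_equiv.refl)
  next
    case t: (Node l g r)
    then have "t' \<noteq> Leaf" using less.prems size1_1_iff[of t] by auto
    then obtain l' g' r' where t': "t' = Node l' g' r'" by (cases t') auto
    have sz: "size1 l + size1 r = size1 l' + size1 r'" using less.prems by (simp add: t t')
    consider "size1 l = size1 l'" | "size1 l < size1 l'" | "size1 l' < size1 l" by linarith
    then show ?thesis
    proof cases
      case 1
      then show ?thesis using less sz unfolding t t'
        by (intro tree_equiv_same_split) auto
    next
      case 2
      then show ?thesis using less sz unfolding t t'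
        by (intro tree_equiv_flip) auto
    next
      case 3
      have "t' \<approx> t" using less sz 3 unfolding t t'
        by (intro tree_equiv_flip) (auto intro: same_labels_sym)
      then show ?thesis by (rule tree_equiv.sym)
    qed
  qed
qed

section \<open>The kernel of the evaluation\<close>

lemma evaluation_apply: "1 \<le> x \<Longrightarrow> x < y \<Longrightarrow> y \<le> size1 t + 1 \<Longrightarrow> evaluation t (x, y) = lab t x y"
  by (simp add: evaluation_def arcs_def)

lemma evaluation_Leaf: "evaluation Leaf = unit_clique one"
  by (auto simp: evaluation_def unit_clique_def fun_eq_iff restrict_def)

lemma evaluation_noncrossing: "evaluation t \<in> noncrossing_cliques one (size1 t)"
proof -
  have "evaluation t (1, 2) = one" if "size1 t = 1"
    using that size1_1_iff[of t] by (simp add: evaluation_apply)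
  then have "evaluation t \<in> cliques one (size1 t)"
    by (auto simp: cliques_def evaluation_def)
  moreover have "\<not> crossing d d'"
    if "d \<in> diagonals (size1 t)" "d' \<in> diagonals (size1 t)" "evaluation t d \<noteq> one" "evaluation t d' \<noteq> one" for d d'
  proof -
    obtain x y x' y' where d: "d = (x, y)" "d' = (x', y')" by fastforce
    have "1 \<le> x" "x < y" "y \<le> size1 t + 1" "1 \<le> x'" "x' < y'" "y' \<le> size1 t + 1"
      using that(1,2) by (auto simp: d diagonals_def arcs_def)
    then show ?thesis using that(3,4) lab_noncrossing[of x x' y y' t] lab_noncrossing[of x' x y' y t]
      by (auto simp: d crossing_def evaluation_apply)
  qed
  ultimately show ?thesis by (auto simp: noncrossing_cliques_def)
qed

lemma evaluation_graft:
  assumes "1 \<le> i" "i \<le> size1 t"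
  shows "evaluation (graft t i s) = clique_comp star one (size1 t) (size1 s) i (evaluation t) (evaluation s)"
proof (rule ext, clarify)
  fix x y
  have pos: "1 \<le> size1 s" by simp
  have sz: "size1 (graft t i s) = size1 t + size1 s - 1" using assms by (rule size1_graft)
  show "evaluation (graft t i s) (x, y) =
    clique_comp star one (size1 t) (size1 s) i (evaluation t) (evaluation s) (x, y)"
  proof (cases "(x, y) \<in> arcs (size1 t + size1 s - 1)")
    case False
    then show ?thesis by (simp only: evaluation_def clique_comp_def sz restrict_apply if_False)
  next
    case True
    then have xy: "1 \<le> x" "x < y" "y \<le> size1 t + size1 s" by (auto simp: arcs_def)
    have "evaluation (graft t i s) (x, y) = lab (graft t i s) x y"
      using xy pos by (intro evaluation_apply) (auto simp: sz)
    also have "\<dots> = (if x = i \<and> y = i + size1 s then star (lab t i (i + 1)) (lab s 1 (size1 s + 1))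
       else if (x \<le> i \<or> i + size1 s \<le> x) \<and> (y \<le> i \<or> i + size1 s \<le> y)
         then lab t (vunshift (size1 s) i x) (vunshift (size1 s) i y)
       else if i \<le> x \<and> y \<le> i + size1 s then lab s (x + 1 - i) (y + 1 - i)
       else one)"
      using assms xy by (rule lab_graft)
    also have "\<dots> = clique_comp star one (size1 t) (size1 s) i (evaluation t) (evaluation s) (x, y)"
    proof -
      have "evaluation t (i, i + 1) = lab t i (i + 1)" "evaluation s (1, size1 s + 1) = lab s 1 (size1 s + 1)"
        using assms pos by (auto intro!: evaluation_apply)
      moreover have "evaluation t (vunshift (size1 s) i x, vunshift (size1 s) i y) =
          lab t (vunshift (size1 s) i x) (vunshift (size1 s) i y)"
        if "(x \<le> i \<or> i + size1 s \<le> x) \<and> (y \<le> i \<or> i + size1 s \<le> y)" "\<not> (x = i \<and> y = i + size1 s)"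
        using that assms xy pos by (intro evaluation_apply) (auto simp: vunshift_def)
      moreover have "evaluation s (x + 1 - i, y + 1 - i) = lab s (x + 1 - i) (y + 1 - i)"
        if "i \<le> x \<and> y \<le> i + size1 s"
        using that assms xy by (intro evaluation_apply) auto
      ultimately show ?thesis using True
        by (simp only: clique_comp_def restrict_apply' case_prod_conv prod.inject) simp
    qed
    finally show ?thesis .
  qed
qed

lemma evaluation_surj:
  assumes p: "p \<in> noncrossing_cliques one n"
  shows "\<exists>t\<in>syntax_trees (triangles one) n. evaluation t = p"
proof -
  have cl: "p \<in> cliques one n" using p by (simp add: noncrossing_cliques_def)
  have "noncrossing n (\<lambda>x y. p (x, y))" unfolding noncrossing_def
  proof (intro allI impI)
    fix x x' y y' assume xy: "1 \<le> x" "x < x'" "x' < y" "y < y'" "y' \<le> n + 1"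
    then have "(x, y) \<in> diagonals n" "(x', y') \<in> diagonals n"
      by (auto simp: diagonals_def arcs_def)
    moreover have "crossing (x, y) (x', y')" using xy by (simp add: crossing_def)
    ultimately show "p (x, y) = one \<or> p (x', y') = one"
      using p by (auto simp: noncrossing_cliques_def)
  qed
  \<comment> \<open>The convention on arity 1 built into \<open>cliques\<close> supplies the side
    condition of \<open>exists_tree\<close>.\<close>
  then obtain t where t: "t \<in> syntax_trees (triangles one) n" "same_labels n (lab t) (\<lambda>x y. p (x, y))"
    using exists_tree[of n "\<lambda>x y. p (x, y)"] cl by (auto simp: cliques_def)
  have "evaluation t = p"
  proof (rule ext, clarify)
    fix x y
    show "evaluation t (x, y) = p (x, y)"
    proof (cases "(x, y) \<in> arcs n")
      case True
      then show ?thesis using t same_labelsD[OF t(2), of x y]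
        by (auto simp: evaluation_def syntax_trees_def arcs_def)
    next
      case False
      moreover have "p \<in> arcs n \<rightarrow>\<^sub>E UNIV" using cl by (simp add: cliques_def)
      ultimately have "p (x, y) = undefined" by (rule PiE_arb[rotated])
      then show ?thesis using False t(1) by (simp add: evaluation_def syntax_trees_def)
    qed
  qed
  then show ?thesis using t(1) by blast
qed

lemma evaluation_eq_imp_equiv:
  assumes "t \<in> syntax_trees (triangles one) n" "s \<in> syntax_trees (triangles one) n" "evaluation t = evaluation s"
  shows "t \<approx> s"
proof (rule tree_equiv_complete)
  show "same_labels (size1 t) (lab t) (lab s)" unfolding same_labels_def
  proof (intro allI impI)
    fix x y assume "1 \<le> x" "x < y" "y \<le> size1 t + 1"
    then show "lab t x y = lab s x y"
      using evaluation_apply[of x y t] evaluation_apply[of x y s] assms by (simp add: syntax_trees_def)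
  qed
qed (use assms in \<open>auto simp: syntax_trees_def\<close>)

section \<open>Evaluation as a linear map compatible with composition\<close>

abbreviation free :: "('k::field, 'm clique tree \<Rightarrow>\<^sub>0 'k) operad" where
  "free \<equiv> free_operad (triangles one)"

lemma component_free: "component free n = {f. Poly_Mapping.keys f \<subseteq> syntax_trees (triangles one) n}"
  and vadd_free: "vadd free n = (+)"
  and vzero_free: "vzero free n = 0"
  and vscale_free: "vscale free n = fscale"
  and pcomp_free: "pcomp free n m i = bilin (\<lambda>t s. graft t i s)"
  and ounit_free: "ounit free = Poly_Mapping.single Leaf 1"
  by (simp_all add: free_operad_def linear_operad_def bilin_def fun_eq_iff)

lemma NC_operad_simps:
  "component (NC_operad star one) n = {f. Poly_Mapping.keys f \<subseteq> noncrossing_cliques one n}"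
  "vadd (NC_operad star one) n = (+)"
  "vscale (NC_operad star one) n = fscale"
  "pcomp (NC_operad star one) n m i = bilin (clique_comp star one n m i)"
  "ounit (NC_operad star one) = Poly_Mapping.single (unit_clique one) 1"
  by (simp_all add: NC_operad_def clique_operad_def linear_operad_def bilin_def fun_eq_iff)

lemma set_tree_graft: "set_tree (graft t i s) \<subseteq> set_tree t \<union> set_tree s"
  by (induction t arbitrary: i) auto

lemma graft_syntax_trees:
  assumes "t \<in> syntax_trees G n" "s \<in> syntax_trees G m" "1 \<le> i" "i \<le> n"
  shows "graft t i s \<in> syntax_trees G (n + m - 1)"
  using assms set_tree_graft[of t i s] by (auto simp: syntax_trees_def size1_graft)

lemma component_free_closed:
  fixes f g :: "'m clique tree \<Rightarrow>\<^sub>0 'k::field"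
  shows "f \<in> component free n \<Longrightarrow> g \<in> component free n \<Longrightarrow> f + g \<in> component free n"
    and "f \<in> component free n \<Longrightarrow> g \<in> component free n \<Longrightarrow> f - g \<in> component free n"
    and "f \<in> component free n \<Longrightarrow> fscale a f \<in> component free n"
    and "f \<in> component free n \<Longrightarrow> g \<in> component free m \<Longrightarrow> 1 \<le> i \<Longrightarrow> i \<le> n \<Longrightarrow>
      bilin (\<lambda>t s. graft t i s) f g \<in> component free (n + m - 1)"
    and "t \<in> syntax_trees (triangles one) n \<Longrightarrow> Poly_Mapping.single t a \<in> component free n"
proof -
  show "f \<in> component free n \<Longrightarrow> g \<in> component free m \<Longrightarrow> 1 \<le> i \<Longrightarrow> i \<le> n \<Longrightarrow>
      bilin (\<lambda>t s. graft t i s) f g \<in> component free (n + m - 1)"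
    unfolding component_free using keys_bilin[of "\<lambda>t s. graft t i s" f g] graft_syntax_trees by blast
qed (use keys_add[of f g] keys_diff[of f g] keys_fscale[of a f] in \<open>auto simp: component_free\<close>)

lemma evaluation_component:
  assumes "f \<in> component free n"
  shows "lin evaluation f \<in> component (NC_operad star one) n"
proof -
  have "evaluation t \<in> noncrossing_cliques one n" if "t \<in> Poly_Mapping.keys f" for t
    using assms that evaluation_noncrossing[of t] by (auto simp: component_free syntax_trees_def)
  then show ?thesis using keys_lin[of evaluation f] by (fastforce simp: NC_operad_simps)
qed

lemma evaluation_pcomp:
  assumes "f \<in> component free n" "g \<in> component free m" "1 \<le> i" "i \<le> n"
  shows "lin evaluation (pcomp free n m i f g) =
    pcomp (NC_operad star one) n m i (lin evaluation f) (lin evaluation g)"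
  unfolding pcomp_free NC_operad_simps
proof (rule lin_bilin)
  fix t s assume "t \<in> Poly_Mapping.keys f" "s \<in> Poly_Mapping.keys g"
  then have "size1 t = n" "size1 s = m"
    using assms(1,2) by (auto simp: component_free syntax_trees_def)
  then show "evaluation (graft t i s) = clique_comp star one n m i (evaluation t) (evaluation s)"
    using evaluation_graft[of i t s] assms(3,4) by simp
qed

definition evaluation_kernel :: "nat \<Rightarrow> ('m clique tree \<Rightarrow>\<^sub>0 'k::field) set" where
  "evaluation_kernel n = {f \<in> component free n. lin evaluation f = 0}"

lemma evaluation_kernel_ideal:
  "operad_ideal (free :: ('k::field, 'm clique tree \<Rightarrow>\<^sub>0 'k) operad) evaluation_kernel"
  unfolding operad_ideal_def
proof (intro conjI allI ballI impI)
  fix n m i and x y :: "'m clique tree \<Rightarrow>\<^sub>0 'k" assume "i \<in> {1..n}" "1 \<le> m" "x \<in> evaluation_kernel n" "y \<in> component free m"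
  then show "pcomp free n m i x y \<in> evaluation_kernel (n + m - 1)"
    using evaluation_pcomp[of x n y m i] component_free_closed(4)[of x n y m i]
    by (simp add: evaluation_kernel_def NC_operad_simps pcomp_free)
next
  fix n m i and x y :: "'m clique tree \<Rightarrow>\<^sub>0 'k" assume "i \<in> {1..n}" "1 \<le> m" "x \<in> component free n" "y \<in> evaluation_kernel m"
  then show "pcomp free n m i x y \<in> evaluation_kernel (n + m - 1)"
    using evaluation_pcomp[of x n y m i] component_free_closed(4)[of x n y m i]
    by (simp add: evaluation_kernel_def NC_operad_simps pcomp_free)
qed (auto simp: evaluation_kernel_def vadd_free vzero_free vscale_free lin_add lin_fscale
    intro: component_free_closed, simp_all add: component_free)

lemma tree_equiv_evaluation:
  assumes "t \<approx> s"
  shows "evaluation t = evaluation s"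
  using tree_equiv_lab[OF assms] tree_equiv_size1[OF assms]
  by (auto simp: evaluation_def fun_eq_iff restrict_def arcs_def same_labels_def)

abbreviation difference :: "'m clique tree \<Rightarrow> 'm clique tree \<Rightarrow> 'm clique tree \<Rightarrow>\<^sub>0 'k::field" where
  "difference t s \<equiv> Poly_Mapping.single t 1 - Poly_Mapping.single s 1"

lemma tree_equiv_kernel:
  assumes "t \<approx> s" "t \<in> syntax_trees (triangles one) n"
  shows "difference t s \<in> evaluation_kernel n"
proof -
  have "s \<in> syntax_trees (triangles one) n"
    using assms tree_equiv_size1[OF assms(1)] tree_equiv_triangles[OF assms(1)]
    by (simp add: syntax_trees_def)
  then show ?thesis using assms
    by (simp add: evaluation_kernel_def lin_diff tree_equiv_evaluation[OF assms(1)] component_free_closed)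
qed

lemma NC_relators_kernel:
  "NC_relators star one \<subseteq> (evaluation_kernel 3 :: ('m clique tree \<Rightarrow>\<^sub>0 'k::field) set)"
proof -
  have "Node (Node Leaf (triangle a b c) Leaf) (triangle d e f) Leaf \<in> syntax_trees (triangles one) 3"
    "Node Leaf (triangle a b c) (Node Leaf (triangle d e f) Leaf) \<in> syntax_trees (triangles one) 3"
    for a b c d e f by (simp_all add: syntax_trees_def)
  note mem = this
  show ?thesis unfolding NC_relators_def tree2_eq
    \<comment> \<open>Each relator is the difference of two trees related by a rule of
      \<open>tree_equiv\<close> in which \<open>A\<close>, \<open>B\<close>, \<open>C\<close> are
      leaves.\<close>
    by (intro Un_least subsetI; elim CollectE exE conjE; erule ssubst; rule tree_equiv_kernel;
        (rule left_left left_right right_right)?; (assumption | rule mem))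
qed

lemma NC_relations_kernel:
  "NC_relations star one n \<subseteq> (evaluation_kernel n :: ('m clique tree \<Rightarrow>\<^sub>0 'k::field) set)"
proof -
  have K: "0 \<in> evaluation_kernel n" "f \<in> evaluation_kernel n \<Longrightarrow> g \<in> evaluation_kernel n \<Longrightarrow> f + g \<in> evaluation_kernel n"
    "f \<in> evaluation_kernel n \<Longrightarrow> fscale a f \<in> evaluation_kernel n" for n a and f g :: "'m clique tree \<Rightarrow>\<^sub>0 'k"
    using evaluation_kernel_ideal unfolding operad_ideal_def vadd_free vzero_free vscale_free by blast+
  have "formal.subspace (evaluation_kernel 3 :: ('m clique tree \<Rightarrow>\<^sub>0 'k) set)"
    unfolding formal.subspace_def using K by blast
  then show ?thesis using NC_relators_kernel K(1)
    by (auto simp: NC_relations_def dest: formal.span_minimal[THEN subsetD, rotated 2])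
qed

section \<open>An arbitrary ideal containing the relators contains the kernel\<close>

context
  fixes I :: "nat \<Rightarrow> ('m clique tree \<Rightarrow>\<^sub>0 'k::field) set"
  assumes ideal: "operad_ideal free I" and relators: "NC_relators star one \<subseteq> I 3"
begin

lemma ideal_zero: "0 \<in> I n"
  and ideal_add: "f \<in> I n \<Longrightarrow> g \<in> I n \<Longrightarrow> f + g \<in> I n"
  and ideal_scale: "f \<in> I n \<Longrightarrow> fscale a f \<in> I n"
  and ideal_pcomp_left: "f \<in> I n \<Longrightarrow> g \<in> component free m \<Longrightarrow> 1 \<le> i \<Longrightarrow> i \<le> n \<Longrightarrow> 1 \<le> m \<Longrightarrow>
    bilin (\<lambda>t s. graft t i s) f g \<in> I (n + m - 1)"
  and ideal_pcomp_right: "f \<in> component free n \<Longrightarrow> g \<in> I m \<Longrightarrow> 1 \<le> i \<Longrightarrow> i \<le> n \<Longrightarrow> 1 \<le> m \<Longrightarrow>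
    bilin (\<lambda>t s. graft t i s) f g \<in> I (n + m - 1)"
  using ideal unfolding operad_ideal_def vadd_free vzero_free vscale_free pcomp_free by auto

lemma ideal_sum: "(\<And>x. x \<in> S \<Longrightarrow> F x \<in> I n) \<Longrightarrow> sum F S \<in> I n"
  by (induction S rule: infinite_finite_induct) (auto intro: ideal_zero ideal_add)

lemma ideal_graft_left:
  assumes "difference a b \<in> I n" "s \<in> syntax_trees (triangles one) m" "1 \<le> i" "i \<le> n"
  shows "difference (graft a i s) (graft b i s) \<in> I (n + m - 1)"
proof -
  have "1 \<le> m" using assms(2) by (auto simp: syntax_trees_def)
  then show ?thesis
    using ideal_pcomp_left[OF assms(1) component_free_closed(5)[OF assms(2), of 1] assms(3,4)]
    by (simp add: bilin_diff_left bilin_single)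
qed

lemma ideal_graft_right:
  assumes "difference a b \<in> I m" "t \<in> syntax_trees (triangles one) n" "1 \<le> i" "i \<le> n" "1 \<le> m"
  shows "difference (graft t i a) (graft t i b) \<in> I (n + m - 1)"
  using ideal_pcomp_right[OF component_free_closed(5)[OF assms(2), of 1] assms(1,3,4,5)]
  by (simp add: bilin_diff_right bilin_single)

text \<open>Grafting from the last leaf to the first keeps the numbers of the leaves still to be
  used.\<close>

lemma ideal_graft_relator:
  assumes "difference a b \<in> I 3" and sub: "set_tree A \<union> set_tree B \<union> set_tree C \<subseteq> triangles one"
  shows "difference (graft (graft (graft a 3 C) 2 B) 1 A) (graft (graft (graft b 3 C) 2 B) 1 A)
    \<in> I (size1 A + size1 B + size1 C)"
proof -
  have mem: "A \<in> syntax_trees (triangles one) (size1 A)" "B \<in> syntax_trees (triangles one) (size1 B)"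
    "C \<in> syntax_trees (triangles one) (size1 C)" using sub by (auto simp: syntax_trees_def)
  have pos: "1 \<le> size1 A" "1 \<le> size1 B" "1 \<le> size1 C" by simp_all
  have "difference (graft (graft (graft a 3 C) 2 B) 1 A) (graft (graft (graft b 3 C) 2 B) 1 A)
      \<in> I (3 + size1 C - 1 + size1 B - 1 + size1 A - 1)"
    by (intro ideal_graft_left assms(1) mem) (use pos in simp_all)
  also have "3 + size1 C - 1 + size1 B - 1 + size1 A - 1 = size1 A + size1 B + size1 C" using pos by simp
  finally show ?thesis .
qed

lemma tree_equiv_ideal:
  assumes "t \<approx> s" "set_tree t \<subseteq> triangles one"
  shows "difference t s \<in> I (size1 t)"
  using assms
proof (induction rule: tree_equiv.induct)
  case (refl t)
  then show ?case by (simp add: ideal_zero)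
next
  case (sym t s)
  then have "difference t s \<in> I (size1 t)" using tree_equiv_triangles by blast
  then have "fscale (- 1) (difference t s) \<in> I (size1 t)" by (rule ideal_scale)
  then show ?case using tree_equiv_size1[OF sym(1)] by (simp add: fscale_minus_one)
next
  case (trans t s u)
  then have "difference t s + difference s u \<in> I (size1 t)"
    using tree_equiv_triangles tree_equiv_size1 by (intro ideal_add) auto
  then show ?case by simp
next
  case (cong_left l l' g r)
  \<comment> \<open>The left subtree is seen as grafted onto leaf 1 of the tree that has a leaf in
    its place, so the ideal element is the inner argument of a composition.\<close>
  have "difference (graft (Node Leaf g r) 1 l) (graft (Node Leaf g r) 1 l') \<in> I (size1 r + 1 + size1 l - 1)"
    by (rule ideal_graft_right) (use cong_left in \<open>auto simp: syntax_trees_def\<close>)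
  then show ?case by (simp add: add.commute)
next
  case (cong_right r r' l g)
  have "difference (graft (Node l g Leaf) (size1 l + 1) r) (graft (Node l g Leaf) (size1 l + 1) r')
      \<in> I (size1 l + 1 + size1 r - 1)"
    by (rule ideal_graft_right) (use cong_right in \<open>auto simp: syntax_trees_def\<close>)
  then show ?case by simp
next
  case (left_left p1 q0 r1 r0 A q1 q2 B p0 p2 C)
  have "difference (Node (Node Leaf (triangle q0 q1 q2) Leaf) (triangle p0 p1 p2) Leaf)
      (Node (Node Leaf (triangle r0 q1 q2) Leaf) (triangle p0 r1 p2) Leaf) \<in> I 3"
    by (rule subsetD[OF relators], unfold NC_relators_def tree2_eq, rule UnI1, rule UnI1)
      (intro CollectI exI conjI, rule HOL.refl, (rule left_left(1,2))+)
  from ideal_graft_relator[OF this, of A B C] left_left(3) show ?case by simp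
next
  case (left_right p1 q0 r2 r0 A q1 q2 B p0 p2 C)
  have "difference (Node (Node Leaf (triangle q0 q1 q2) Leaf) (triangle p0 p1 p2) Leaf)
      (Node Leaf (triangle p0 q1 r2) (Node Leaf (triangle r0 q2 p2) Leaf)) \<in> I 3"
    by (rule subsetD[OF relators], unfold NC_relators_def tree2_eq, rule UnI1, rule UnI2)
      (intro CollectI exI conjI, rule HOL.refl, (rule left_right(1,2))+)
  from ideal_graft_relator[OF this, of A B C] left_right(3) show ?case by simp
next
  case (right_right p2 q0 r2 r0 A p0 p1 B q1 q2 C)
  have "difference (Node Leaf (triangle p0 p1 p2) (Node Leaf (triangle q0 q1 q2) Leaf))
      (Node Leaf (triangle p0 p1 r2) (Node Leaf (triangle r0 q1 q2) Leaf)) \<in> I 3"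
    by (rule subsetD[OF relators], unfold NC_relators_def tree2_eq, rule UnI2)
      (intro CollectI exI conjI, rule HOL.refl, (rule right_right(1,2))+)
  from ideal_graft_relator[OF this, of A B C] right_right(3) show ?case by (simp add: add.assoc)
qed

text \<open>
  Replacing every tree by the chosen tree with the same evaluation changes an element of the free
  operad by an element of the ideal, and maps the kernel to zero.
\<close>

lemma kernel_subset_ideal: "evaluation_kernel n \<subseteq> I n"
proof
  fix f :: "'m clique tree \<Rightarrow>\<^sub>0 'k" assume f: "f \<in> evaluation_kernel n"
  \<comment> \<open>The choice depends on the clique \<open>p\<close> only, so trees with equal
    evaluation get the same representative.\<close>
  define \<sigma> where "\<sigma> p = (SOME t. t \<in> syntax_trees (triangles one) n \<and> evaluation t = p)" for p
  have \<sigma>: "\<sigma> (evaluation t) \<in> syntax_trees (triangles one) n \<and> evaluation (\<sigma> (evaluation t)) = evaluation t"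
    if "t \<in> syntax_trees (triangles one) n" for t
    unfolding \<sigma>_def by (rule someI[of _ t]) (simp add: that)
  \<comment> \<open>The subtracted term is zero because \<open>f\<close> lies in the kernel.\<close>
  have "f = lin (\<lambda>t. t) f - lin \<sigma> (lin evaluation f)"
    using f by (simp add: lin_id evaluation_kernel_def)
  also have "\<dots> = (\<Sum>t\<in>Poly_Mapping.keys f. fscale (Poly_Mapping.lookup f t) (difference t (\<sigma> (evaluation t))))"
    unfolding lin_comp by (simp add: lin_def formal.scale_right_diff_distrib sum_subtractf
        flip: single_scale)
  also have "\<dots> \<in> I n"
  proof (rule ideal_sum)
    fix t assume "t \<in> Poly_Mapping.keys f"
    then have t: "t \<in> syntax_trees (triangles one) n"
      using f by (auto simp: evaluation_kernel_def component_free)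
    then have "t \<approx> \<sigma> (evaluation t)" using \<sigma>[OF t] by (intro evaluation_eq_imp_equiv) auto
    then show "fscale (Poly_Mapping.lookup f t) (difference t (\<sigma> (evaluation t))) \<in> I n"
      using t tree_equiv_ideal[of t] by (intro ideal_scale) (auto simp: syntax_trees_def)
  qed
  finally show "f \<in> I n" .
qed

end

text \<open>The kernel is itself one of the ideals being intersected, and it is contained in each of
  the others.\<close>

lemma generated_ideal_eq_kernel:
  "generated_ideal free (NC_relations star one) n =
    (evaluation_kernel n :: ('m clique tree \<Rightarrow>\<^sub>0 'k::field) set)"
    (is "?G = ?K")
proof
  show "?G \<subseteq> ?K"
    unfolding generated_ideal_def using evaluation_kernel_ideal NC_relations_kernel by blast
  have sub: "evaluation_kernel n \<subseteq> I n" if "operad_ideal free I" "\<forall>k. NC_relations star one k \<subseteq> I k"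
    for I :: "nat \<Rightarrow> ('m clique tree \<Rightarrow>\<^sub>0 'k) set"
  proof (rule kernel_subset_ideal[OF that(1)])
    have "NC_relators star one \<subseteq> NC_relations star one 3"
      by (simp add: NC_relations_def formal.span_superset)
    then show "NC_relators star one \<subseteq> I 3" using that(2) by blast
  qed
  show "?K \<subseteq> ?G"
    unfolding generated_ideal_def
  proof (rule Inter_greatest, elim CollectE exE conjE)
    fix X and I :: "nat \<Rightarrow> ('m clique tree \<Rightarrow>\<^sub>0 'k) set"
    assume X: "X = I n" and I: "operad_ideal free I" "\<forall>k. NC_relations star one k \<subseteq> I k"
    show "?K \<subseteq> X" unfolding X using I by (rule sub)
  qed
qed

section \<open>The presentation, by the first isomorphism theorem\<close>

lemma NC_operad_presentation:
  "operad_isomorphic (NC_operad star one :: ('k::field, 'm clique \<Rightarrow>\<^sub>0 'k) operad)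
    (quotient_operad free (generated_ideal free (NC_relations star one)))"
proof (rule quotient_operad_isomorphic[where f = "\<lambda>n. lin evaluation"])
  let ?P = "free :: ('k, 'm clique tree \<Rightarrow>\<^sub>0 'k) operad"
  show "operad_hom ?P (NC_operad star one) (\<lambda>n. lin evaluation)"
    unfolding operad_hom_def
  proof (intro conjI allI ballI impI)
    fix n m i x y assume "i \<in> {1..n}" "x \<in> component ?P n" "y \<in> component ?P m" "1 \<le> m"
    then show "lin evaluation (pcomp ?P n m i x y) =
        pcomp (NC_operad star one) n m i (lin evaluation x) (lin evaluation y)"
      by (intro evaluation_pcomp) auto
  qed (auto simp: evaluation_component vadd_free vscale_free ounit_free NC_operad_simps(2-)
      lin_add lin_fscale evaluation_Leaf)
  show "lin evaluation ` component ?P n = component (NC_operad star one) n" for n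
  proof (intro subset_antisym subsetI)
    fix f :: "'m clique \<Rightarrow>\<^sub>0 'k" assume f: "f \<in> component (NC_operad star one) n"
    have "\<forall>p\<in>noncrossing_cliques one n. \<exists>t. t \<in> syntax_trees (triangles one) n \<and> evaluation t = p"
      using evaluation_surj by blast
    \<comment> \<open>A section of evaluation on basis elements; its linear extension gives
      preimages of all linear combinations.\<close>
    then obtain \<sigma> where \<sigma>: "\<forall>p\<in>noncrossing_cliques one n. \<sigma> p \<in> syntax_trees (triangles one) n \<and> evaluation (\<sigma> p) = p"
      by metis
    have keys: "Poly_Mapping.keys f \<subseteq> noncrossing_cliques one n" using f by (simp add: NC_operad_simps)
    have "lin evaluation (lin \<sigma> f) = lin (\<lambda>p. p) f"
      unfolding lin_comp using keys \<sigma> by (intro lin_cong) auto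
    moreover have "lin \<sigma> f \<in> component ?P n"
      using keys_lin[of \<sigma> f] keys \<sigma> by (fastforce simp: component_free)
    ultimately show "f \<in> lin evaluation ` component ?P n" by (metis image_eqI lin_id)
  qed (use evaluation_component in blast)
  \<comment> \<open>Since the generated ideal is the kernel, cosets are fibres: \<open>y\<close> and
    \<open>x\<close> have the same image exactly when \<open>y - x\<close> is in the kernel.\<close>
  show "coset ?P (generated_ideal ?P (NC_relations star one)) n x =
      {y \<in> component ?P n. lin evaluation y = lin evaluation x}" if "x \<in> component ?P n" for n x
  proof (intro subset_antisym subsetI)
    fix y assume "y \<in> {y \<in> component ?P n. lin evaluation y = lin evaluation x}"
    then have "y - x \<in> evaluation_kernel n" "y = x + (y - x)"
      using that by (simp_all add: evaluation_kernel_def lin_diff component_free_closed)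
    then show "y \<in> coset ?P (generated_ideal ?P (NC_relations star one)) n x"
      unfolding coset_def generated_ideal_eq_kernel vadd_free by (metis image_eqI)
  qed (use that in \<open>auto simp: coset_def generated_ideal_eq_kernel vadd_free evaluation_kernel_def
      lin_add component_free_closed\<close>)
  show "pcomp ?P n m i x y \<in> component ?P (n + m - 1)"
    if "x \<in> component ?P n" "y \<in> component ?P m" "1 \<le> i" "i \<le> n" "1 \<le> m" for n m i x y
    unfolding pcomp_free using that(1-4) by (rule component_free_closed)
  show "ounit ?P \<in> component ?P 1"
    unfolding ounit_free by (rule component_free_closed) (simp add: syntax_trees_def)
qed (simp_all add: vadd_free vscale_free component_free_closed)

end

theorem theorem3p15:
  fixes star :: "'m::finite \<Rightarrow> 'm \<Rightarrow> 'm" and one :: 'm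
  assumes "unitary_magma star one"
  shows "operad_isomorphic
    (NC_operad star one :: ('k::field_char_0, 'm clique \<Rightarrow>\<^sub>0 'k) operad)
    (quotient_operad (free_operad (triangles one))
       (generated_ideal (free_operad (triangles one)) (NC_relations star one)))"
  using assms by (rule unitary_magma.NC_operad_presentation)

end
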